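(* For every integer $n\ge1$, the number of spanning trees of the quartered Aztec diamond $QAD_n$ equals $$\prod_{1\leq j<k\leq n-1}\left(4-2\cos\frac{j\pi}{n}-2\cos\frac{k\pi}{n}\right).$$
   Context: The Aztec diamond $AD_n$ is the subgraph of the grid $(\mathbb{Z}+1/2)^2$ (nearest-neighbor edges) induced by the vertices $(x,y)$ with $|x|+|y|\le n$. The quartered Aztec diamond $QAD_n$ is the subgraph of $AD_n$ induced by the vertices in its southeastern quarter ($x>0$, $y<0$); equivalently, up to isomorphism, it is the subgraph of $\mathbb{Z}^2$ induced by the points $(i,j)$ with $i,j\ge1$, $i+j\le n+1$. Empty products equal $1$. *)

theory Defs
  imports Complex_Main
begin

text \<open>
  Undirected graphs are pairs of a vertex set and a set of two-element edges. The notion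
  \<open>spanning_tree\<close> of the AFP entry \<open>Graph_Theory\<close> is not suitable here: graphs are symmetric
  digraphs there and its forests exclude only directed cycles, so that a single undirected edge
  (two opposite arcs) already contains a cycle, while a non-directed orientation of a cycle is
  a forest.
\<close>

type_synonym 'a ugraph = "'a set \<times> 'a set set"

abbreviation uverts :: "'a ugraph \<Rightarrow> 'a set" where
  "uverts G \<equiv> fst G"

abbreviation uedges :: "'a ugraph \<Rightarrow> 'a set set" where
  "uedges G \<equiv> snd G"

definition wf_ugraph :: "'a ugraph \<Rightarrow> bool" where
  "wf_ugraph G \<longleftrightarrow> (\<forall>e \<in> uedges G. e \<subseteq> uverts G \<and> card e = 2)"

definition induced_ugraph :: "'a ugraph \<Rightarrow> 'a set \<Rightarrow> 'a ugraph" where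
  "induced_ugraph G W = (uverts G \<inter> W, {e \<in> uedges G. e \<subseteq> W})"

definition uconnected :: "'a ugraph \<Rightarrow> bool" where
  "uconnected G \<longleftrightarrow> uverts G \<noteq> {} \<and>
     (\<forall>u \<in> uverts G. \<forall>v \<in> uverts G. (\<lambda>a b. {a, b} \<in> uedges G)\<^sup>*\<^sup>* u v)"

text \<open>A cycle is given by its cyclic list of at least three distinct vertices.\<close>

definition ucycle :: "'a ugraph \<Rightarrow> 'a list \<Rightarrow> bool" where
  "ucycle G vs \<longleftrightarrow> 3 \<le> length vs \<and> distinct vs \<and>
     (\<forall>i < length vs. {vs ! i, vs ! (Suc i mod length vs)} \<in> uedges G)"

definition utree :: "'a ugraph \<Rightarrow> bool" where
  "utree G \<longleftrightarrow> wf_ugraph G \<and> uconnected G \<and> (\<nexists>vs. ucycle G vs)"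

definition spanning_utrees :: "'a ugraph \<Rightarrow> 'a ugraph set" where
  "spanning_utrees G = {T. uverts T = uverts G \<and> uedges T \<subseteq> uedges G \<and> utree T}"

definition half_integer_grid :: "(real \<times> real) ugraph" where
  "half_integer_grid =
     (let V = {(x, y). x - 1/2 \<in> \<int> \<and> y - 1/2 \<in> \<int>} in
      (V, {{(x, y), (x', y')} | x y x' y'.
             (x, y) \<in> V \<and> (x', y') \<in> V \<and> \<bar>x - x'\<bar> + \<bar>y - y'\<bar> = 1}))"

definition aztec_diamond :: "nat \<Rightarrow> (real \<times> real) ugraph" where
  "aztec_diamond n = induced_ugraph half_integer_grid {(x, y). \<bar>x\<bar> + \<bar>y\<bar> \<le> real n}"

definition quartered_aztec_diamond :: "nat \<Rightarrow> (real \<times> real) ugraph" where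
  "quartered_aztec_diamond n = induced_ugraph (aztec_diamond n) {(x, y). x > 0 \<and> y < 0}"

lemma wf_half_integer_grid: "wf_ugraph half_integer_grid"
  by (auto simp: wf_ugraph_def half_integer_grid_def Let_def card_2_iff) fastforce+

lemma wf_induced_ugraph: "wf_ugraph G \<Longrightarrow> wf_ugraph (induced_ugraph G W)"
  by (auto simp: wf_ugraph_def induced_ugraph_def)

lemma wf_quartered_aztec_diamond: "wf_ugraph (quartered_aztec_diamond n)"
  unfolding quartered_aztec_diamond_def aztec_diamond_def
  by (intro wf_induced_ugraph wf_half_integer_grid)

text \<open>The vertices correspond to the points \<open>(i, j)\<close> with \<open>i, j \<ge> 1\<close> and \<open>i + j \<le> n + 1\<close>.\<close>

lemma uverts_quartered_aztec_diamond:
  "uverts (quartered_aztec_diamond n) =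
     (\<lambda>(i, j). (real_of_int i - 1/2, 1/2 - real_of_int j)) `
       {(i, j). 1 \<le> i \<and> 1 \<le> j \<and> i + j \<le> int n + 1}" (is "?L = ?R")
proof
  show "?L \<subseteq> ?R"
  proof
    fix p assume "p \<in> ?L"
    then obtain x y where p: "p = (x, y)" and xy: "x - 1/2 \<in> \<int>" "y - 1/2 \<in> \<int>"
        "\<bar>x\<bar> + \<bar>y\<bar> \<le> real n" "x > 0" "y < 0"
      by (auto simp: quartered_aztec_diamond_def aztec_diamond_def induced_ugraph_def
          half_integer_grid_def)
    from xy(1,2) obtain a b where ab: "x - 1/2 = of_int a" "y - 1/2 = of_int b"
      by (auto elim!: Ints_cases)
    have "real_of_int a > -1" "real_of_int b < 0" "real_of_int a - real_of_int b \<le> real n"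
      using ab xy by linarith+
    then have "1 \<le> a + 1" "1 \<le> - b" "a + 1 + - b \<le> int n + 1"
      by linarith+
    moreover have "p = (real_of_int (a + 1) - 1/2, 1/2 - real_of_int (- b))"
      using ab p by simp
    ultimately show "p \<in> ?R" by (intro image_eqI[where x = "(a + 1, - b)"]) auto
  qed
  show "?R \<subseteq> ?L"
  proof
    fix p assume "p \<in> ?R"
    then obtain i j where p: "p = (real_of_int i - 1/2, 1/2 - real_of_int j)"
      and ij: "1 \<le> i" "1 \<le> j" "i + j \<le> int n + 1" by auto
    have "real_of_int i - 1/2 - 1/2 = of_int (i - 1)"
      "1/2 - real_of_int j - 1/2 = of_int (- j)" by simp_all
    then have "real_of_int i - 1/2 - 1/2 \<in> \<int>" "1/2 - real_of_int j - 1/2 \<in> \<int>"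
      by (metis Ints_of_int)+
    moreover have "real_of_int i \<ge> 1" "real_of_int j \<ge> 1"
        "real_of_int i + real_of_int j \<le> real n + 1"
      using ij by linarith+
    ultimately show "p \<in> ?L" unfolding p
      by (auto simp: quartered_aztec_diamond_def aztec_diamond_def induced_ugraph_def
          half_integer_grid_def)
  qed
qed

end

theory Submission
  imports Defs "Jordan_Normal_Form.Determinant"
begin

text \<open>
  Let \<open>C\<close> be the signed incidence matrix between the bounded faces and the edges of the quartered
  Aztec diamond. Every bounded face has four edges, so \<open>C C\<^sup>T = 4 I - A\<close>, where \<open>A\<close> is the adjacency
  matrix of the faces, which form a triangle cut off from a square grid by its diagonal. Its
  eigenvectors are the antisymmetrised products of sines, and the determinant of \<open>C C\<^sup>T\<close> is the
  product in the theorem. On the other hand, by Cauchy--Binet this determinant is the sum of the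
  squared maximal minors of \<open>C\<close>. Each minor is \<open>0\<close> or \<open>\<plusminus>1\<close>, since a column has at most one entry \<open>1\<close> and
  at most one entry \<open>-1\<close>. The kernel of \<open>C\<close> consists of the differences of vertex potentials, so the
  minor of an edge set \<open>S\<close> vanishes iff some nonconstant potential is constant along all edges
  outside \<open>S\<close>, that is, iff the complement of \<open>S\<close> is disconnected. As \<open>S\<close> has as many elements as there
  are bounded faces, its complement is connected iff it is a spanning tree.
\<close>

section \<open>Spanning trees and connectedness\<close>

lemma uconnected_imp_constant:
  assumes "uconnected (V, T)" and edge: "\<And>a b. {a, b} \<in> T \<Longrightarrow> h a = h b"
    and "u \<in> V" "v \<in> V"
  shows "h u = h v"
proof -
  have "(\<lambda>a b. {a, b} \<in> T)\<^sup>*\<^sup>* u v" using assms by (simp add: uconnected_def)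
  then show ?thesis by induction (use edge in auto)
qed

text \<open>It suffices to test the indicator function of the vertices reachable from
  \<open>u\<close>. This form of connectedness, by integer potentials, is the one that kernels of
  integer matrices speak about.\<close>

lemma uconnectedI_constant:
  assumes "V \<noteq> {}"
    and const: "\<And>(h :: 'a \<Rightarrow> int) u v. \<lbrakk>\<And>a b. {a, b} \<in> T \<Longrightarrow> h a = h b; u \<in> V; v \<in> V\<rbrakk> \<Longrightarrow> h u = h v"
  shows "uconnected (V, T)"
  unfolding uconnected_def fst_conv snd_conv
proof (intro conjI ballI)
  fix u v assume uv: "u \<in> V" "v \<in> V"
  let ?R = "(\<lambda>a b. {a, b} \<in> T)\<^sup>*\<^sup>*"
  have "(of_bool (?R u u) :: int) = of_bool (?R u v)"
  proof (rule const[of "\<lambda>w. of_bool (?R u w)", OF _ uv])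
    fix a b assume ab: "{a, b} \<in> T"
    then have "{b, a} \<in> T" by (simp add: insert_commute)
    with ab have "?R u a \<longleftrightarrow> ?R u b" by (auto intro: rtranclp.rtrancl_into_rtrancl)
    then show "(of_bool (?R u a) :: int) = of_bool (?R u b)" by simp
  qed
  then show "?R u v" by (simp split: if_splits)
qed fact

text \<open>Otherwise membership in \<open>W\<close> would be constant along all edges.\<close>

lemma uconnected_cut:
  assumes "uconnected (V, T)" "W \<subseteq> V" "W \<noteq> {}" "W \<noteq> V"
  obtains a b where "{a, b} \<in> T" "a \<in> W" "b \<notin> W"
proof (rule ccontr)
  assume none: "\<not> thesis"
  have "a \<in> W \<longleftrightarrow> b \<in> W" if "{a, b} \<in> T" for a b
  proof -
    have "{b, a} \<in> T" using that by (simp add: insert_commute)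
    with \<open>{a, b} \<in> T\<close> none show ?thesis using \<open>\<And>b a. \<lbrakk>{a, b} \<in> T; a \<in> W; b \<notin> W\<rbrakk> \<Longrightarrow> thesis\<close> by blast
  qed
  moreover from assms(2-4) obtain u v where "u \<in> V" "v \<in> V" "u \<in> W" "v \<notin> W" by blast
  ultimately show False using uconnected_imp_constant[OF assms(1), of "\<lambda>w. w \<in> W" u v] by blast
qed

text \<open>A tree is grown from a single vertex: each step crosses the cut around the current
  vertex set and adds one edge together with one new vertex.\<close>

lemma uconnected_sparse_subgraph:
  assumes conn: "uconnected (V, T)" and fin: "finite V" and wf: "wf_ugraph (V, T)"
  obtains P where "P \<subseteq> T" "uconnected (V, P)" "card P + 1 = card V"
proof -
  have ne: "V \<noteq> {}" using conn by (simp add: uconnected_def)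
  \<comment> \<open>Keeping the edges of \<open>P\<close> inside \<open>W\<close> ensures that an
    edge leaving \<open>W\<close> is new, so \<open>card P\<close> really increases.\<close>
  have "\<exists>W P. W \<subseteq> V \<and> card W = Suc k \<and> P \<subseteq> T \<inter> Pow W \<and> card P = k \<and> uconnected (W, P)"
    if "Suc k \<le> card V" for k
    using that
  proof (induction k)
    case 0
    obtain r where "r \<in> V" using ne by blast
    then show ?case
      by (intro exI[of _ "{r}"] exI[of _ "{}"]) (auto simp: uconnected_def)
  next
    case (Suc k)
    then obtain W P where W: "W \<subseteq> V" "card W = Suc k" "P \<subseteq> T \<inter> Pow W" "card P = k" "uconnected (W, P)"
      by auto
    obtain a b where ab: "{a, b} \<in> T" "a \<in> W" "b \<notin> W"
    proof -
      have "W \<noteq> {}" "W \<noteq> V" using W(2) Suc.prems by auto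
      then show ?thesis using uconnected_cut[OF conn W(1)] that by blast
    qed
    have b: "b \<in> V" using wf ab(1) by (auto simp: wf_ugraph_def)
    have finW: "finite W" using W(1) fin finite_subset by blast
    then have finP: "finite P" using W(3) finite_subset[of P "Pow W"] by blast
    have "uconnected (insert b W, insert {a, b} P)"
    proof (rule uconnectedI_constant)
      fix h :: "'a \<Rightarrow> int" and u v
      assume h: "\<And>x y. {x, y} \<in> insert {a, b} P \<Longrightarrow> h x = h y"
        and uv: "u \<in> insert b W" "v \<in> insert b W"
      have "h w = h a" if "w \<in> insert b W" for w
      proof (cases "w = b")
        case True
        then show ?thesis using h[of a b] by simp
      next
        case False
        with that have "w \<in> W" by simp
        then show ?thesis using uconnected_imp_constant[OF W(5), of h w a] h ab(2) by blast
      qed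
      then show "h u = h v" using uv by metis
    qed simp
    moreover have "{a, b} \<notin> P" using W(3) ab(3) by blast
    ultimately show ?case
      using W ab b finW finP
      by (intro exI[of _ "insert b W"] exI[of _ "insert {a, b} P"]) auto
  qed
  moreover have "Suc (card V - 1) = card V" using ne fin card_gt_0_iff[of V] by simp
  ultimately obtain W P where
    W: "W \<subseteq> V" "card W = card V" "P \<subseteq> T" "card P + 1 = card V" "uconnected (W, P)"
    by (metis Suc_eq_plus1 le_inf_iff order_refl)
  then have "W = V" using fin by (simp add: card_subset_eq)
  with W that show ?thesis by blast
qed

text \<open>When the next vertex \<open>z\<close> already lies on the path, the path is cut back to
  \<open>z\<close>; otherwise \<open>z\<close> is appended.\<close>

lemma rtranclp_imp_simple_path:
  assumes "R\<^sup>*\<^sup>* u v"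
  shows "\<exists>xs. xs \<noteq> [] \<and> hd xs = u \<and> last xs = v \<and> distinct xs \<and> successively R xs"
  using assms
proof induction
  case base
  show ?case by (intro exI[of _ "[u]"]) simp
next
  case (step y z)
  then obtain xs where xs: "xs \<noteq> []" "hd xs = u" "last xs = y" "distinct xs" "successively R xs"
    by blast
  show ?case
  proof (cases "z \<in> set xs")
    case True
    then obtain ys zs where "xs = ys @ z # zs" by (meson split_list)
    with xs show ?thesis
      by (intro exI[of _ "ys @ [z]"]) (auto simp: successively_append_iff hd_append)
  next
    case False
    with xs step.hyps show ?thesis
      by (intro exI[of _ "xs @ [z]"]) (auto simp: successively_append_iff)
  qed
qed

text \<open>Both directions use a connected subgraph \<open>P\<close> with \<open>card V - 1\<close>
  edges. If \<open>T\<close> is acyclic, then \<open>P = T\<close>, since a path in \<open>P\<close>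
  between the ends of a leftover edge would close a cycle.\<close>

lemma utree_iff_connected_card:
  assumes fin: "finite V" and wf: "wf_ugraph (V, T)"
  shows "utree (V, T) \<longleftrightarrow> uconnected (V, T) \<and> card T + 1 = card V"
proof -
  have finT: "finite T"
    using wf fin finite_subset[of T "Pow V"] by (auto simp: wf_ugraph_def)
  have "card T + 1 = card V" if conn: "uconnected (V, T)" and acyc: "\<nexists>vs. ucycle (V, T) vs"
  proof -
    obtain P where P: "P \<subseteq> T" "uconnected (V, P)" "card P + 1 = card V"
      using uconnected_sparse_subgraph[OF conn fin wf] .
    have "P = T"
    proof (rule ccontr)
      assume "P \<noteq> T"
      then obtain e where e: "e \<in> T" "e \<notin> P" using P(1) by blast
      then obtain u v where uv: "e = {u, v}" "u \<noteq> v" "u \<in> V" "v \<in> V"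
        using wf by (fastforce simp: wf_ugraph_def card_2_iff)
      then obtain xs where xs: "xs \<noteq> []" "hd xs = u" "last xs = v" "distinct xs"
          "successively (\<lambda>a b. {a, b} \<in> P) xs"
        using rtranclp_imp_simple_path[of _ u v] P(2) unfolding uconnected_def fst_conv snd_conv
        by blast
      have nth: "{xs ! i, xs ! Suc i} \<in> P" if "Suc i < length xs" for i
        using xs(5) that by (simp add: successively_conv_nth)
      have ends: "xs ! 0 = u" "xs ! (length xs - 1) = v"
        using xs by (simp_all add: hd_conv_nth last_conv_nth)
      \<comment> \<open>A single vertex would give \<open>u = v\<close>, and two vertices would put
        \<open>e\<close> into \<open>P\<close>.\<close>
      have "length xs \<noteq> 1" using ends uv(2) by auto
      moreover have "length xs \<noteq> 2" using nth[of 0] ends e(2) uv(1) by auto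
      ultimately have len: "3 \<le> length xs"
        using xs(1) length_greater_0_conv[of xs] by linarith
      have "{xs ! i, xs ! (Suc i mod length xs)} \<in> T" if "i < length xs" for i
      proof (cases "Suc i = length xs")
        case True
        then have "i = length xs - 1" by simp
        then show ?thesis using True ends e(1) uv(1) by (simp add: insert_commute)
      next
        case False
        then show ?thesis using that nth[of i] P(1) by auto
      qed
      then have "ucycle (V, T) xs" using len xs(4) by (simp add: ucycle_def)
      with acyc show False by blast
    qed
    with P show ?thesis by simp
  qed
  \<comment> \<open>Deleting an edge of a cycle leaves a connected graph with too few edges.\<close>
  moreover have False
    if conn: "uconnected (V, T)" and cd: "card T + 1 = card V" and cyc: "ucycle (V, T) vs" for vs
  proof -
    let ?k = "length vs"
    define e where "e = {vs ! 0, vs ! 1}"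
    have k: "3 \<le> ?k" and dist: "distinct vs"
      and edge: "\<And>i. i < ?k \<Longrightarrow> {vs ! i, vs ! (Suc i mod ?k)} \<in> T"
      using cyc by (auto simp: ucycle_def)
    have step: "{vs ! i, vs ! Suc i} \<in> T" if "Suc i < ?k" for i
      using edge[of i] that by (metis Suc_lessD mod_less)
    have ne: "vs \<noteq> []" using k by auto
    have eT: "e \<in> T" using step[of 0] k by (simp add: e_def)
    have "uconnected (V, T - {e})"
    proof (rule uconnectedI_constant)
      show "V \<noteq> {}" using conn by (simp add: uconnected_def)
      fix h :: "'a \<Rightarrow> int" and u v
      assume h: "\<And>a b. {a, b} \<in> T - {e} \<Longrightarrow> h a = h b" and uv: "u \<in> V" "v \<in> V"
      \<comment> \<open>The other way round the cycle, from \<open>vs ! 1\<close> through the last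
        vertex back to \<open>vs ! 0\<close>, avoids \<open>e\<close>; so \<open>h\<close> agrees at
        the two ends of \<open>e\<close> as well.\<close>
      have along: "h (vs ! Suc i) = h (vs ! 1)" if "Suc i < ?k" for i
        using that
      proof (induction i)
        case (Suc i)
        have "{vs ! Suc i, vs ! Suc (Suc i)} \<noteq> e"
          using dist ne Suc.prems by (auto simp: e_def doubleton_eq_iff nth_eq_iff_index_eq)
        with step[of "Suc i"] Suc.prems have "h (vs ! Suc i) = h (vs ! Suc (Suc i))"
          by (intro h) auto
        with Suc show ?case by simp
      qed simp
      have "{vs ! (?k - 1), vs ! 0} \<noteq> e"
      proof -
        have "vs ! (?k - 1) \<noteq> vs ! 0" "vs ! (?k - 1) \<noteq> vs ! 1"
          using dist ne k by (auto simp: nth_eq_iff_index_eq)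
        then show ?thesis by (auto simp: e_def doubleton_eq_iff)
      qed
      moreover have "{vs ! (?k - 1), vs ! 0} \<in> T" using edge[of "?k - 1"] k by (metis Suc_diff_1 diff_less less_numeral_extra(1) mod_self order_less_le_trans zero_less_numeral)
      ultimately have "h (vs ! (?k - 1)) = h (vs ! 0)" by (intro h) auto
      moreover have "h (vs ! (?k - 1)) = h (vs ! 1)" using along[of "?k - 2"] k
        by (simp add: numeral_eq_Suc Suc_diff_Suc)
      ultimately have "h a = h b" if "{a, b} = e" for a b
        using that by (auto simp: e_def doubleton_eq_iff)
      with h have "h a = h b" if "{a, b} \<in> T" for a b using that by blast
      then show "h u = h v" by (rule uconnected_imp_constant[OF conn]) (use uv in auto)
    qed
    moreover have "wf_ugraph (V, T - {e})" using wf by (simp add: wf_ugraph_def)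
    ultimately obtain P where P: "P \<subseteq> T - {e}" "card P + 1 = card V"
      using uconnected_sparse_subgraph[OF _ fin] by metis
    have "card P \<le> card (T - {e})" using P(1) finT by (intro card_mono) auto
    also have "\<dots> < card T" using eT finT by (intro card_Diff1_less)
    finally show False using P(2) cd by simp
  qed
  ultimately show ?thesis using wf unfolding utree_def by blast
qed

lemma card_spanning_utrees:
  assumes fin: "finite V" and wf: "wf_ugraph (V, E)"
  shows "card (spanning_utrees (V, E)) = card {T. T \<subseteq> E \<and> card T + 1 = card V \<and> uconnected (V, T)}"
proof -
  have "utree (V, T) \<longleftrightarrow> uconnected (V, T) \<and> card T + 1 = card V" if "T \<subseteq> E" for T
    using wf that by (intro utree_iff_connected_card[OF fin]) (auto simp: wf_ugraph_def)
  then have "spanning_utrees (V, E) =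
      Pair V ` {T. T \<subseteq> E \<and> card T + 1 = card V \<and> uconnected (V, T)}"
    by (auto simp: spanning_utrees_def)
  then show ?thesis by (simp add: card_image inj_on_def)
qed

section \<open>Determinants\<close>

lemma det_columns_permute:
  fixes c :: "nat \<Rightarrow> 'e \<Rightarrow> 'a :: comm_ring_1"
  assumes q: "q permutes {0..<m}"
  shows "det (mat m m (\<lambda>(i, j). c i (f (q j)))) = signof q * det (mat m m (\<lambda>(i, j). c i (f j)))"
proof -
  let ?A = "mat m m (\<lambda>(i, j). c j (f i))"
  have q_less: "q i < m" if "i < m" for i using permutes_in_image[OF q, of i] that by simp
  have tr: "det (mat m m (\<lambda>(i, j). c i (f (g j)))) = det (mat m m (\<lambda>(i, j). c j (f (g i))))" for g
    by (subst det_transpose[symmetric, where n = m])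
      (auto intro!: arg_cong[where f = det] eq_matI)
  have "det (mat m m (\<lambda>(i, j). c i (f (q j)))) = det (mat m m (\<lambda>(i, j). ?A $$ (q i, j)))"
    unfolding tr by (auto intro!: arg_cong[where f = det] eq_matI simp: q_less)
  also have "\<dots> = signof q * det ?A" by (rule det_permute_rows[OF _ q]) simp
  also have "det ?A = det (mat m m (\<lambda>(i, j). c i (f j)))" using tr[of id] by simp
  finally show ?thesis .
qed

text \<open>
  Summing over functions instead of subsets, each subset being counted \<open>m!\<close> times, avoids choosing
  an order of the columns; the square arises by averaging the expansion over all permutations of
  the columns.
\<close>

theorem Cauchy_Binet_gram:
  fixes c :: "nat \<Rightarrow> 'e \<Rightarrow> 'a :: comm_ring_1"
  assumes E: "finite E"
  shows "of_nat (fact m) * det (mat m m (\<lambda>(i, j). \<Sum>e \<in> E. c i e * c j e)) =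
    (\<Sum>f \<in> {0..<m} \<rightarrow>\<^sub>E E. (det (mat m m (\<lambda>(i, j). c i (f j))))\<^sup>2)"
proof -
  let ?P = "{p. p permutes {0..<m}}" and ?F = "{0..<m} \<rightarrow>\<^sub>E E"
  define D where "D f = det (mat m m (\<lambda>(i, j). c i (f j)))" for f :: "nat \<Rightarrow> 'e"
  define M where "M = det (mat m m (\<lambda>(i, j). \<Sum>e \<in> E. c i e * c j e))"
  have perm_less: "p i < m" if "p permutes {0..<m}" "i < m" for p i
    using permutes_in_image[OF that(1), of i] that(2) by simp
  \<comment> \<open>The expansion along columns appears when the product of sums in \<open>M\<close>
    is multiplied out; the one along rows collapses the sum over \<open>q\<close> at the
    end.\<close>
  have Drow: "D f = (\<Sum>p \<in> ?P. signof p * (\<Prod>i = 0..<m. c i (f (p i))))" for f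
    unfolding D_def by (subst det_def'[of _ m]) (auto intro!: sum.cong prod.cong simp: perm_less)
  have Dcol: "D f = (\<Sum>p \<in> ?P. signof p * (\<Prod>i = 0..<m. c (p i) (f i)))" for f
    unfolding D_def
    by (subst det_col[of _ m]) (auto intro!: sum.cong prod.cong simp: perm_less atLeast0LessThan)
  have M: "M = (\<Sum>f \<in> ?F. (\<Prod>i = 0..<m. c i (f i)) * D f)"
  proof -
    have "M = (\<Sum>p \<in> ?P. signof p * (\<Prod>i = 0..<m. \<Sum>e \<in> E. c i e * c (p i) e))"
      unfolding M_def by (subst det_def'[of _ m]) (auto intro!: sum.cong prod.cong simp: perm_less)
    also have "\<dots> = (\<Sum>p \<in> ?P. \<Sum>f \<in> ?F. signof p * ((\<Prod>i = 0..<m. c i (f i)) * (\<Prod>i = 0..<m. c (p i) (f i))))"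
      using E by (simp add: prod_sum_PiE sum_distrib_left prod.distrib)
    also have "\<dots> = (\<Sum>f \<in> ?F. \<Sum>p \<in> ?P. signof p * ((\<Prod>i = 0..<m. c i (f i)) * (\<Prod>i = 0..<m. c (p i) (f i))))"
      by (rule sum.swap)
    also have "\<dots> = (\<Sum>f \<in> ?F. (\<Prod>i = 0..<m. c i (f i)) * D f)"
      unfolding Dcol by (simp add: sum_distrib_left algebra_simps)
    finally show ?thesis .
  qed
  \<comment> \<open>Replacing \<open>f\<close> by \<open>f \<circ> q\<close> permutes the columns:
    the sign comes from \<open>D\<close>, the permuted product from the first factor. Summed over
    \<open>q\<close>, these signed products form a second factor \<open>D f\<close>.\<close>
  have Mq: "M = (\<Sum>f \<in> ?F. (signof q * (\<Prod>i = 0..<m. c i (f (q i)))) * D f)" if q: "q \<in> ?P" for q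
  proof -
    have qi: "Hilbert_Choice.inv q permutes {0..<m}" using q by (simp add: permutes_inv)
    have mem: "f \<circ> r \<in> ?F" if "f \<in> ?F" "r permutes {0..<m}" for f r
    proof (rule PiE_I)
      fix i assume "i \<in> {0..<m}"
      then have "r i \<in> {0..<m}" using permutes_in_image[OF that(2)] by blast
      then show "(f \<circ> r) i \<in> E" using that(1) by auto
    next
      fix i assume "i \<notin> {0..<m}"
      then have "r i = i" "f i = undefined"
        using permutes_not_in[OF that(2)] PiE_arb[OF that(1)] by auto
      then show "(f \<circ> r) i = undefined" by simp
    qed
    have "bij_betw (\<lambda>f. f \<circ> q) ?F ?F"
      using q qi by (intro bij_betw_byWitness[where f' = "\<lambda>f. f \<circ> Hilbert_Choice.inv q"])
        (auto intro!: mem simp: o_assoc[symmetric] permutes_inv_o[of q "{0..<m}"])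
    then have "M = (\<Sum>f \<in> ?F. (\<Prod>i = 0..<m. c i ((f \<circ> q) i)) * D (f \<circ> q))"
      unfolding M by (rule sum.reindex_bij_betw[symmetric])
    moreover have "D (f \<circ> q) = signof q * D f" for f
      using q unfolding D_def o_def by (intro det_columns_permute) simp
    ultimately show ?thesis by (simp add: ac_simps)
  qed
  have "of_nat (fact m) * M = (\<Sum>q \<in> ?P. M)"
    by (simp add: card_permutations[where n = m])
  also have "\<dots> = (\<Sum>q \<in> ?P. \<Sum>f \<in> ?F. (signof q * (\<Prod>i = 0..<m. c i (f (q i)))) * D f)"
    by (rule sum.cong[OF refl Mq])
  also have "\<dots> = (\<Sum>f \<in> ?F. \<Sum>q \<in> ?P. (signof q * (\<Prod>i = 0..<m. c i (f (q i)))) * D f)"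
    by (rule sum.swap)
  also have "\<dots> = (\<Sum>f \<in> ?F. (D f)\<^sup>2)"
    by (simp add: Drow sum_distrib_right power2_eq_square)
  finally show ?thesis unfolding M_def D_def .
qed

text \<open>An injection from \<open>m\<close> indices into a set of \<open>m\<close> elements is
  onto, so each \<open>S\<close> is the image of exactly \<open>fact m\<close> of them. This is the
  factor that occurs in \<open>Cauchy_Binet_gram\<close>.\<close>

lemma card_injections_image:
  assumes E: "finite E"
  shows "card {f \<in> {0..<m} \<rightarrow>\<^sub>E E. inj_on f {0..<m} \<and> Q (f ` {0..<m})} =
    fact m * card {S. S \<subseteq> E \<and> card S = m \<and> Q S}"
proof -
  let ?I = "\<lambda>S. {f \<in> {0..<m} \<rightarrow>\<^sub>E S. inj_on f {0..<m}}"
  let ?S = "{S. S \<subseteq> E \<and> card S = m \<and> Q S}"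
  have img: "f ` {0..<m} = S" if "f \<in> ?I S" "S \<in> ?S" for f S
    using that E by (intro card_subset_eq) (auto simp: card_image finite_subset)
  have "{f \<in> {0..<m} \<rightarrow>\<^sub>E E. inj_on f {0..<m} \<and> Q (f ` {0..<m})} = (\<Union>S \<in> ?S. ?I S)"
  proof (intro equalityI subsetI)
    fix f assume f: "f \<in> {f \<in> {0..<m} \<rightarrow>\<^sub>E E. inj_on f {0..<m} \<and> Q (f ` {0..<m})}"
    then have "f \<in> ?I (f ` {0..<m})" "f ` {0..<m} \<in> ?S"
      by (auto simp: card_image PiE_def)
    then show "f \<in> (\<Union>S \<in> ?S. ?I S)" by blast
  next
    fix f assume "f \<in> (\<Union>S \<in> ?S. ?I S)"
    then obtain S where "S \<in> ?S" "f \<in> ?I S" by blast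
    with img[OF this(2,1)] show "f \<in> {f \<in> {0..<m} \<rightarrow>\<^sub>E E. inj_on f {0..<m} \<and> Q (f ` {0..<m})}"
      by (auto simp: PiE_def)
  qed
  also have "card \<dots> = (\<Sum>S \<in> ?S. card (?I S))"
  proof (rule card_UN_disjoint)
    show "finite ?S" using E by simp
    show "\<forall>S\<in>?S. finite (?I S)"
    proof
      fix S assume "S \<in> ?S"
      then have "finite ({0..<m} \<rightarrow>\<^sub>E S)" using E finite_subset by (intro finite_PiE) auto
      then show "finite (?I S)" by simp
    qed
    show "\<forall>S\<in>?S. \<forall>S'\<in>?S. S \<noteq> S' \<longrightarrow> ?I S \<inter> ?I S' = {}"
    proof (intro ballI impI equals0I)
      fix S S' f assume S: "S \<in> ?S" "S' \<in> ?S" "S \<noteq> S'" and f: "f \<in> ?I S \<inter> ?I S'"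
      show False using S(3) img[OF IntD1[OF f] S(1)] img[OF IntD2[OF f] S(2)] by simp
    qed
  qed
  also have "\<dots> = (\<Sum>S \<in> ?S. fact m)"
  proof (rule sum.cong[OF refl])
    fix S assume S: "S \<in> ?S"
    then have "finite S" using E finite_subset by auto
    then have "card (?I S) = (\<Prod>i = 0..<m. m - i)"
      using card_inj_on_subset_funcset[of "{0..<m}" S "{0..<m}"] S by simp
    then show "card (?I S) = fact m" by (simp add: fact_prod_rev)
  qed
  finally show ?thesis by simp
qed

text \<open>The total unimodularity argument for signed incidence matrices. A column with at most
  one nonzero entry allows expansion to a smaller matrix of the same kind; if there is no such
  column, the determinant vanishes.\<close>

lemma det_at_most_one_pm1_per_column:
  fixes A :: "int mat"
  assumes "A \<in> carrier_mat n n"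
    and "\<And>i j. i < n \<Longrightarrow> j < n \<Longrightarrow> A $$ (i, j) \<in> {-1, 0, 1}"
    and "\<And>i i' j. \<lbrakk>i < n; i' < n; j < n; A $$ (i, j) = A $$ (i', j); A $$ (i, j) \<noteq> 0\<rbrakk> \<Longrightarrow> i = i'"
  shows "det A \<in> {-1, 0, 1}"
  using assms
proof (induction n arbitrary: A)
  case 0
  then show ?case by simp
next
  case (Suc n)
  note A = Suc.prems
  show ?case
  proof (cases "\<exists>j < Suc n. \<exists>i < Suc n. \<forall>i' < Suc n. i' \<noteq> i \<longrightarrow> A $$ (i', j) = 0")
    case True
    then obtain i j where ij: "i < Suc n" "j < Suc n"
      and zero: "\<And>i'. \<lbrakk>i' < Suc n; i' \<noteq> i\<rbrakk> \<Longrightarrow> A $$ (i', j) = 0" by blast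
    have "det A = (\<Sum>k<Suc n. A $$ (k, j) * cofactor A k j)"
      by (rule laplace_expansion_column[OF A(1) ij(2)])
    also have "\<dots> = A $$ (i, j) * cofactor A i j"
      using zero ij(1) by (subst sum.remove[of _ i]) (auto intro!: sum.neutral)
    finally have "det A = A $$ (i, j) * ((-1) ^ (i + j) * det (mat_delete A i j))"
      by (simp add: cofactor_def)
    moreover have "det (mat_delete A i j) \<in> {-1, 0, 1}"
    proof (rule Suc.IH)
      show "mat_delete A i j \<in> carrier_mat n n" using A(1) by (auto simp: mat_delete_def)
      fix k l assume kl: "k < n" "l < n"
      have eq: "mat_delete A i j $$ (k, l) =
          A $$ (if k < i then k else Suc k, if l < j then l else Suc l)"
        if "k < n" "l < n" for k l
        using A(1) that by (auto simp: mat_delete_def)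
      show "mat_delete A i j $$ (k, l) \<in> {-1, 0, 1}" unfolding eq[OF kl] using kl by (intro A(2)) auto
      fix k' assume k': "k' < n" "mat_delete A i j $$ (k, l) = mat_delete A i j $$ (k', l)"
        "mat_delete A i j $$ (k, l) \<noteq> 0"
      then have "(if k < i then k else Suc k) = (if k' < i then k' else Suc k')"
        unfolding eq[OF kl] eq[OF k'(1) kl(2)] using kl by (intro A(3)) auto
      then show "k = k'" by (auto split: if_splits)
    qed
    moreover have "A $$ (i, j) \<in> {-1, 0, 1}" using A(2) ij by blast
    moreover have "(-1 :: int) ^ (i + j) \<in> {-1, 1}" by (cases "even (i + j)") auto
    ultimately show ?thesis by auto
  next
    case False
    \<comment> \<open>Every column consists of one \<open>1\<close>, one \<open>-1\<close> and zeros, so the rows sum to zero.\<close>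
    have col_sum: "(\<Sum>i<Suc n. A $$ (i, j)) = 0" if j: "j < Suc n" for j
    proof -
      obtain i where i: "i < Suc n" "A $$ (i, j) \<noteq> 0" using False j by blast
      obtain k where k: "k < Suc n" "k \<noteq> i" "A $$ (k, j) \<noteq> 0" using False j i(1) by blast
      have ne: "A $$ (i, j) \<noteq> A $$ (k, j)" using A(3)[OF i(1) k(1) j] i k by blast
      have rest: "A $$ (l, j) = 0" if l: "l < Suc n" "l \<noteq> i" "l \<noteq> k" for l
        using A(2)[OF i(1) j] A(2)[OF k(1) j] A(2)[OF l(1) j] i k ne
          A(3)[OF i(1) l(1) j] A(3)[OF k(1) l(1) j] l by auto
      have "(\<Sum>l<Suc n. A $$ (l, j)) = A $$ (i, j) + (A $$ (k, j) + 0)"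
        using i(1) k(1,2) rest
        by (subst sum.remove[of _ i], simp, simp, subst sum.remove[of _ k]) (auto intro!: sum.neutral)
      then show ?thesis using A(2)[OF i(1) j] A(2)[OF k(1) j] i k ne by auto
    qed
    have "transpose_mat A *\<^sub>v vec (Suc n) (\<lambda>_. 1) = 0\<^sub>v (Suc n)"
      using A(1) col_sum by (intro eq_vecI) (auto simp: scalar_prod_def atLeast0LessThan)
    moreover have "vec (Suc n) (\<lambda>_. 1) \<noteq> (0\<^sub>v (Suc n) :: int vec)"
      by (metis index_vec index_zero_vec(1) zero_less_Suc zero_neq_one)
    ultimately have "det (transpose_mat A) = 0"
      using A(1) by (subst det_0_iff_vec_prod_zero[of _ "Suc n"]) (auto intro!: exI[of _ "vec (Suc n) (\<lambda>_. 1)"])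
    then show ?thesis using det_transpose[OF A(1)] by simp
  qed
qed

section \<open>The quartered Aztec diamond as a triangle\<close>

text \<open>
  The vertex \<open>(i, j)\<close> of the quartered Aztec diamond is written \<open>(x, y) = (i, n + 1 - j)\<close>, so that
  the vertices are \<open>triangle n\<close>. The unit square with lower left corner \<open>(a, b)\<close> is a bounded face
  iff \<open>(a, b) \<in> strict_triangle (n - 1)\<close>.
\<close>

definition triangle :: "nat \<Rightarrow> (nat \<times> nat) set" where
  "triangle n = {(x, y). 1 \<le> x \<and> x \<le> y \<and> y \<le> n}"

definition strict_triangle :: "nat \<Rightarrow> (nat \<times> nat) set" where
  "strict_triangle n = {(x, y). 1 \<le> x \<and> x < y \<and> y \<le> n}"

datatype tri_edge = Hor nat nat | Ver nat nat

fun tail :: "tri_edge \<Rightarrow> nat \<times> nat" where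
  "tail (Hor x y) = (x, y)"
| "tail (Ver x y) = (x, y)"

fun head :: "tri_edge \<Rightarrow> nat \<times> nat" where
  "head (Hor x y) = (Suc x, y)"
| "head (Ver x y) = (x, Suc y)"

text \<open>Both ends must be vertices: for \<open>Hor x y\<close> this means
  \<open>Suc x \<le> y\<close>, hence the strict triangle; for \<open>Ver x y\<close> it means
  \<open>Suc y \<le> n\<close>, hence the smaller triangle.\<close>

definition tri_edges :: "nat \<Rightarrow> tri_edge set" where
  "tri_edges n = case_prod Hor ` strict_triangle n \<union> case_prod Ver ` triangle (n - 1)"

text \<open>The boundary of the face \<open>(a, b)\<close>, oriented counterclockwise.\<close>

fun boundary :: "nat \<times> nat \<Rightarrow> tri_edge \<Rightarrow> int" where
  "boundary (a, b) e = of_bool (e = Hor a b) - of_bool (e = Hor a (Suc b))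
     + of_bool (e = Ver (Suc a) b) - of_bool (e = Ver a b)"

declare boundary.simps [simp del]

section \<open>Membership, finiteness and Euler's formula\<close>

lemma Hor_in_tri_edges [simp]: "Hor x y \<in> tri_edges n \<longleftrightarrow> 1 \<le> x \<and> x < y \<and> y \<le> n"
  by (auto simp: tri_edges_def strict_triangle_def)

lemma Ver_in_tri_edges [simp]: "Ver x y \<in> tri_edges n \<longleftrightarrow> 1 \<le> x \<and> x \<le> y \<and> y < n"
  by (auto simp: tri_edges_def triangle_def)

lemma finite_triangle [simp]: "finite (triangle n)"
  by (rule finite_subset[of _ "{..n} \<times> {..n}"]) (auto simp: triangle_def)

lemma finite_strict_triangle [simp]: "finite (strict_triangle n)"
  by (rule finite_subset[of _ "{..n} \<times> {..n}"]) (auto simp: strict_triangle_def)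

lemma finite_tri_edges [simp]: "finite (tri_edges n)"
  by (simp add: tri_edges_def)

text \<open>Euler's formula, counting bounded faces only. Removing the top row \<open>y = n\<close>
  reduces both kinds of triangle to the next smaller size, and the removed rows of \<open>n\<close>
  and \<open>n - 1\<close> points differ by one.\<close>

lemma card_tri_edges:
  assumes "1 \<le> n"
  shows "card (tri_edges n) + 1 = card (triangle n) + card (strict_triangle (n - 1))"
proof -
  have "card (tri_edges n) = card (strict_triangle n) + card (triangle (n - 1))"
    unfolding tri_edges_def
    by (subst card_Un_disjoint)
      (auto intro!: arg_cong2[where f = "(+)"] card_image simp: inj_on_def)
  moreover have "card (strict_triangle n) = card (strict_triangle (n - 1)) + (n - 1)"
  proof -
    have "strict_triangle n = strict_triangle (n - 1) \<union> (\<lambda>x. (x, n)) ` {1..<n}"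
      using assms by (auto simp: strict_triangle_def)
    moreover have "strict_triangle (n - 1) \<inter> (\<lambda>x. (x, n)) ` {1..<n} = {}"
      using assms by (auto simp: strict_triangle_def)
    ultimately have "card (strict_triangle n) = card (strict_triangle (n - 1)) + card ((\<lambda>x. (x, n)) ` {1..<n})"
      using card_Un_disjoint[of "strict_triangle (n - 1)" "(\<lambda>x. (x, n)) ` {1..<n}"] by simp
    then show ?thesis by (simp add: card_image inj_on_def)
  qed
  moreover have "card (triangle n) = card (triangle (n - 1)) + n"
  proof -
    have "triangle n = triangle (n - 1) \<union> (\<lambda>x. (x, n)) ` {1..n}"
      using assms by (auto simp: triangle_def)
    moreover have "triangle (n - 1) \<inter> (\<lambda>x. (x, n)) ` {1..n} = {}"
      using assms by (auto simp: triangle_def)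
    ultimately have "card (triangle n) = card (triangle (n - 1)) + card ((\<lambda>x. (x, n)) ` {1..n})"
      using card_Un_disjoint[of "triangle (n - 1)" "(\<lambda>x. (x, n)) ` {1..n}"] by simp
    then show ?thesis by (simp add: card_image inj_on_def)
  qed
  ultimately show ?thesis using assms by simp
qed

text \<open>The circulation of \<open>\<psi>\<close> around a face. All four sides are edges of the
  triangle; for the right side \<open>Ver (Suc a) b\<close> this uses \<open>a < b\<close>.\<close>

lemma sum_boundary_tri_edges:
  fixes \<psi> :: "tri_edge \<Rightarrow> 'a :: comm_ring_1"
  assumes "(a, b) \<in> strict_triangle (n - 1)"
  shows "(\<Sum>e \<in> tri_edges n. of_int (boundary (a, b) e) * \<psi> e) =
    \<psi> (Hor a b) - \<psi> (Hor a (Suc b)) + \<psi> (Ver (Suc a) b) - \<psi> (Ver a b)"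
proof -
  have pick: "(\<Sum>e \<in> tri_edges n. of_bool (e = e0) * \<psi> e) = \<psi> e0" if "e0 \<in> tri_edges n" for e0
    using that by (simp add: of_bool_def if_distrib[of "\<lambda>x. x * _"] cong: if_cong)
  have mem: "Hor a b \<in> tri_edges n" "Hor a (Suc b) \<in> tri_edges n" "Ver (Suc a) b \<in> tri_edges n"
      "Ver a b \<in> tri_edges n"
    using assms by (auto simp: strict_triangle_def)
  have "(\<Sum>e \<in> tri_edges n. of_int (boundary (a, b) e) * \<psi> e) =
      (\<Sum>e \<in> tri_edges n. of_bool (e = Hor a b) * \<psi> e) - (\<Sum>e \<in> tri_edges n. of_bool (e = Hor a (Suc b)) * \<psi> e)
      + (\<Sum>e \<in> tri_edges n. of_bool (e = Ver (Suc a) b) * \<psi> e) - (\<Sum>e \<in> tri_edges n. of_bool (e = Ver a b) * \<psi> e)"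
    by (simp only: boundary.simps of_int_add of_int_diff of_int_of_bool sum.distrib sum_subtractf algebra_simps)
  also have "\<dots> = \<psi> (Hor a b) - \<psi> (Hor a (Suc b)) + \<psi> (Ver (Suc a) b) - \<psi> (Ver a b)"
    by (simp only: pick mem)
  finally show ?thesis .
qed

text \<open>The transposed sum: only the two faces on either side of the edge contribute, with
  opposite signs. As \<open>v\<close> vanishes outside \<open>F\<close>, edges on the outer boundary
  need no separate formula.\<close>

lemma sum_boundary_faces:
  fixes v :: "nat \<times> nat \<Rightarrow> 'a :: comm_ring_1"
  assumes F: "finite F" and v: "\<And>g. g \<notin> F \<Longrightarrow> v g = 0"
  shows "1 \<le> y \<Longrightarrow> (\<Sum>g \<in> F. of_int (boundary g (Hor x y)) * v g) = v (x, y) - v (x, y - 1)"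
    and "1 \<le> x \<Longrightarrow> (\<Sum>g \<in> F. of_int (boundary g (Ver x y)) * v g) = v (x - 1, y) - v (x, y)"
proof -
  have pick: "(\<Sum>g \<in> F. of_bool (g = g0) * v g) = v g0" for g0
    using F v by (cases "g0 \<in> F")
      (auto simp: of_bool_def if_distrib[of "\<lambda>x. x * _"] cong: if_cong)
  show "(\<Sum>g \<in> F. of_int (boundary g (Hor x y)) * v g) = v (x, y) - v (x, y - 1)" if "1 \<le> y"
  proof -
    have "(of_int (boundary g (Hor x y)) :: 'a) = of_bool (g = (x, y)) - of_bool (g = (x, y - 1))" for g
      using that by (cases g) (auto simp: boundary.simps)
    then show ?thesis by (simp only: left_diff_distrib sum_subtractf pick)
  qed
  show "(\<Sum>g \<in> F. of_int (boundary g (Ver x y)) * v g) = v (x - 1, y) - v (x, y)" if "1 \<le> x"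
  proof -
    have "(of_int (boundary g (Ver x y)) :: 'a) = of_bool (g = (x - 1, y)) - of_bool (g = (x, y))" for g
      using that by (cases g) (auto simp: boundary.simps)
    then show ?thesis by (simp only: left_diff_distrib sum_subtractf pick)
  qed
qed

lemma boundary_values: "boundary g e \<in> {-1, 0, 1}"
  by (cases g; cases e) (auto simp: boundary.simps)

text \<open>The two faces at an edge traverse it in opposite directions.\<close>

lemma boundary_inj: "boundary g e = boundary g' e \<Longrightarrow> boundary g e \<noteq> 0 \<Longrightarrow> g = g'"
  by (cases g; cases g'; cases e) (auto simp: boundary.simps of_bool_def split: if_splits)

text \<open>Phrased by integer potentials, as in \<open>uconnectedI_constant\<close>, so that it can
  be compared directly with the kernel of a minor.\<close>

definition tri_connected :: "nat \<Rightarrow> tri_edge set \<Rightarrow> bool" where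
  "tri_connected n T \<longleftrightarrow> (\<forall>h :: nat \<times> nat \<Rightarrow> int.
     (\<forall>e \<in> T. h (tail e) = h (head e)) \<longrightarrow> (\<forall>u \<in> triangle n. \<forall>v \<in> triangle n. h u = h v))"

lemma tail_head_in_triangle: "e \<in> tri_edges n \<Longrightarrow> tail e \<in> triangle n \<and> head e \<in> triangle n"
  by (cases e) (auto simp: triangle_def)

lemma tri_connected_tri_edges: "tri_connected n (tri_edges n)"
  unfolding tri_connected_def
proof (intro allI impI)
  fix h :: "nat \<times> nat \<Rightarrow> int"
  assume h: "\<forall>e \<in> tri_edges n. h (tail e) = h (head e)"
  have col: "h (1, Suc y) = h (1, 1)" if "Suc y \<le> n" for y
    using that
  proof (induction y)
    case (Suc y)
    with bspec[OF h, of "Ver 1 (Suc y)"] show ?case by simp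
  qed simp
  have row: "h (Suc x, y) = h (1, y)" if "Suc x \<le> y" "y \<le> n" for x y
    using that
  proof (induction x)
    case (Suc x)
    with bspec[OF h, of "Hor (Suc x) y"] show ?case by simp
  qed simp
  have "h p = h (1, 1)" if "p \<in> triangle n" for p
  proof -
    from that obtain x y where "p = (Suc x, Suc y)" "Suc x \<le> Suc y" "Suc y \<le> n"
      by (cases p; cases "fst p"; cases "snd p") (auto simp: triangle_def)
    then show ?thesis using row[of x "Suc y"] col[of y] by simp
  qed
  then show "\<forall>u \<in> triangle n. \<forall>v \<in> triangle n. h u = h v" by metis
qed

text \<open>Integrate first up the column \<open>x = 1\<close>, then along the row of the endpoint.\<close>

lemma closed_imp_exact:
  fixes \<psi> :: "tri_edge \<Rightarrow> 'a :: comm_ring_1"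
  assumes closed: "\<And>g. g \<in> strict_triangle (n - 1) \<Longrightarrow> (\<Sum>e \<in> tri_edges n. of_int (boundary g e) * \<psi> e) = 0"
  shows "\<exists>h. \<forall>e \<in> tri_edges n. \<psi> e = h (head e) - h (tail e)"
proof -
  define h where "h = (\<lambda>(x, y). (\<Sum>t = 1..<y. \<psi> (Ver 1 t)) + (\<Sum>s = 1..<x. \<psi> (Hor s y)))"
  \<comment> \<open>Horizontal edges fit the definition of \<open>h\<close>, and so do vertical ones
    in the column \<open>x = 1\<close>. The vanishing circulation around the face between two
    columns carries the identity from one column to the next.\<close>
  have ver: "\<psi> (Ver (Suc x) y) = h (Suc x, Suc y) - h (Suc x, y)" if "Suc x \<le> y" "y < n" for x y
    using that
  proof (induction x)
    case 0
    then show ?case by (simp add: h_def)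
  next
    case (Suc x)
    have "(Suc x, y) \<in> strict_triangle (n - 1)" using Suc.prems by (auto simp: strict_triangle_def)
    from closed[OF this, unfolded sum_boundary_tri_edges[OF this]]
    have "\<psi> (Hor (Suc x) y) - \<psi> (Hor (Suc x) (Suc y)) + \<psi> (Ver (Suc (Suc x)) y) - \<psi> (Ver (Suc x) y) = 0"
      .
    moreover have "h (Suc (Suc x), z) = h (Suc x, z) + \<psi> (Hor (Suc x) z)" for z
      by (simp add: h_def)
    ultimately show ?case using Suc by (simp add: algebra_simps)
  qed
  have "\<psi> e = h (head e) - h (tail e)" if "e \<in> tri_edges n" for e
  proof (cases e)
    case (Hor x y)
    with that show ?thesis by (simp add: h_def)
  next
    case (Ver x y)
    with that show ?thesis using ver[of "x - 1" y] by simp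
  qed
  then show ?thesis by blast
qed

section \<open>Isomorphism of the triangle with the quartered Aztec diamond\<close>

definition grid_point :: "nat \<Rightarrow> nat \<times> nat \<Rightarrow> real \<times> real" where
  "grid_point n = (\<lambda>(x, y). (real x - 1/2, real y - real n - 1/2))"

definition grid_edge :: "nat \<Rightarrow> tri_edge \<Rightarrow> (real \<times> real) set" where
  "grid_edge n e = {grid_point n (tail e), grid_point n (head e)}"

lemma inj_grid_point: "inj (grid_point n)"
  by (auto simp: inj_def grid_point_def)

lemma inj_grid_edge: "inj (grid_edge n)"
proof (rule injI)
  fix e e' assume "grid_edge n e = grid_edge n e'"
  then have "{tail e, head e} = {tail e', head e'}"
    unfolding grid_edge_def using inj_image_eq_iff[OF inj_grid_point[of n], of "{tail e, head e}" "{tail e', head e'}"]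
    by simp
  then show "e = e'" by (cases e; cases e') (auto simp: doubleton_eq_iff)
qed

lemma uverts_quartered_aztec_diamond_triangle:
  "uverts (quartered_aztec_diamond n) = grid_point n ` triangle n"
proof -
  have "{(i, j). 1 \<le> i \<and> 1 \<le> j \<and> i + j \<le> int n + 1} =
      (\<lambda>(x, y). (int x, int n + 1 - int y)) ` triangle n" (is "?L = ?f ` _")
  proof (intro equalityI subsetI)
    fix p assume "p \<in> ?L"
    then obtain i j where "p = (i, j)" "1 \<le> i" "1 \<le> j" "i + j \<le> int n + 1" by auto
    then have "p = ?f (nat i, nat (int n + 1 - j))" "(nat i, nat (int n + 1 - j)) \<in> triangle n"
      by (auto simp: triangle_def)
    then show "p \<in> ?f ` triangle n" by (rule image_eqI)
  qed (auto simp: triangle_def)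
  then show ?thesis
    unfolding uverts_quartered_aztec_diamond image_image
    by (auto simp: grid_point_def image_image algebra_simps intro!: image_cong)
qed

lemma uedges_quartered_aztec_diamond:
  "uedges (quartered_aztec_diamond n) =
    {{p, q} | p q. p \<in> uverts (quartered_aztec_diamond n) \<and> q \<in> uverts (quartered_aztec_diamond n)
      \<and> \<bar>fst p - fst q\<bar> + \<bar>snd p - snd q\<bar> = 1}" (is "_ = ?R")
proof (intro equalityI subsetI)
  fix e assume "e \<in> uedges (quartered_aztec_diamond n)"
  then obtain x y x' y' where e: "e = {(x, y), (x', y')}" and
    "(x, y) \<in> uverts half_integer_grid" "(x', y') \<in> uverts half_integer_grid"
    and d: "\<bar>x - x'\<bar> + \<bar>y - y'\<bar> = 1" and
    "e \<subseteq> {(x, y). \<bar>x\<bar> + \<bar>y\<bar> \<le> real n}" "e \<subseteq> {(x, y). x > 0 \<and> y < 0}"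
    unfolding quartered_aztec_diamond_def aztec_diamond_def induced_ugraph_def
      half_integer_grid_def Let_def by auto
  then have "(x, y) \<in> uverts (quartered_aztec_diamond n)" "(x', y') \<in> uverts (quartered_aztec_diamond n)"
    unfolding quartered_aztec_diamond_def aztec_diamond_def induced_ugraph_def by auto
  with e d show "e \<in> ?R" by fastforce
next
  fix e assume "e \<in> ?R"
  then obtain p q where "e = {p, q}" "p \<in> uverts (quartered_aztec_diamond n)"
    "q \<in> uverts (quartered_aztec_diamond n)" "\<bar>fst p - fst q\<bar> + \<bar>snd p - snd q\<bar> = 1" by auto
  then show "e \<in> uedges (quartered_aztec_diamond n)"
    unfolding quartered_aztec_diamond_def aztec_diamond_def induced_ugraph_def
      half_integer_grid_def Let_def by (cases p; cases q) fastforce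
qed

lemma quartered_aztec_diamond_eq:
  "quartered_aztec_diamond n = (grid_point n ` triangle n, grid_edge n ` tri_edges n)"
proof -
  have "uedges (quartered_aztec_diamond n) = grid_edge n ` tri_edges n"
    unfolding uedges_quartered_aztec_diamond uverts_quartered_aztec_diamond_triangle
  proof (intro equalityI subsetI)
    fix e
    assume "e \<in> {{p, q} | p q. p \<in> grid_point n ` triangle n \<and> q \<in> grid_point n ` triangle n \<and> \<bar>fst p - fst q\<bar> + \<bar>snd p - snd q\<bar> = 1}"
    then obtain x y x' y' where e: "e = {grid_point n (x, y), grid_point n (x', y')}"
      and mem: "(x, y) \<in> triangle n" "(x', y') \<in> triangle n"
      and "\<bar>real x - real x'\<bar> + \<bar>real y - real y'\<bar> = 1"
      by (auto simp: grid_point_def)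
    then have "\<bar>int x - int x'\<bar> + \<bar>int y - int y'\<bar> = 1" by linarith
    then consider "x' = Suc x" "y' = y" | "x = Suc x'" "y' = y" | "x' = x" "y' = Suc y" | "x' = x" "y = Suc y'"
      by linarith
    then show "e \<in> grid_edge n ` tri_edges n"
    proof cases
      case 1
      then show ?thesis using e mem by (intro image_eqI[of _ _ "Hor x y"]) (auto simp: grid_edge_def triangle_def)
    next
      case 2
      then show ?thesis using e mem by (intro image_eqI[of _ _ "Hor x' y"]) (auto simp: grid_edge_def triangle_def)
    next
      case 3
      then show ?thesis using e mem by (intro image_eqI[of _ _ "Ver x y"]) (auto simp: grid_edge_def triangle_def)
    next
      case 4
      then show ?thesis using e mem by (intro image_eqI[of _ _ "Ver x y'"]) (auto simp: grid_edge_def triangle_def)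
    qed
  next
    fix e assume "e \<in> grid_edge n ` tri_edges n"
    then obtain d where d: "e = grid_edge n d" "d \<in> tri_edges n" by blast
    have "\<bar>fst (grid_point n (tail d)) - fst (grid_point n (head d))\<bar> + \<bar>snd (grid_point n (tail d)) - snd (grid_point n (head d))\<bar> = 1"
      by (cases d) (auto simp: grid_point_def)
    then show "e \<in> {{p, q} | p q. p \<in> grid_point n ` triangle n \<and> q \<in> grid_point n ` triangle n \<and> \<bar>fst p - fst q\<bar> + \<bar>snd p - snd q\<bar> = 1}"
      using d tail_head_in_triangle[OF d(2)] unfolding grid_edge_def by blast
  qed
  then show ?thesis by (simp add: prod_eq_iff uverts_quartered_aztec_diamond_triangle)
qed

text \<open>Potentials are carried over along the injection \<open>grid_point n\<close> and along
  its inverse.\<close>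

lemma uconnected_grid_point_iff:
  assumes "1 \<le> n"
  shows "uconnected (grid_point n ` triangle n, grid_edge n ` T) \<longleftrightarrow> tri_connected n T"
proof
  assume conn: "uconnected (grid_point n ` triangle n, grid_edge n ` T)"
  show "tri_connected n T"
    unfolding tri_connected_def
  proof (intro allI impI ballI)
    fix h :: "nat \<times> nat \<Rightarrow> int" and u v
    assume h: "\<forall>e \<in> T. h (tail e) = h (head e)" and uv: "u \<in> triangle n" "v \<in> triangle n"
    have inv [simp]: "Hilbert_Choice.inv (grid_point n) (grid_point n p) = p" for p using inj_grid_point by (rule inv_f_f)
    have "(h \<circ> Hilbert_Choice.inv (grid_point n)) (grid_point n u) = (h \<circ> Hilbert_Choice.inv (grid_point n)) (grid_point n v)"
    proof (rule uconnected_imp_constant[OF conn])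
      fix a b assume "{a, b} \<in> grid_edge n ` T"
      then obtain e where "e \<in> T" "{a, b} = {grid_point n (tail e), grid_point n (head e)}"
        by (auto simp: grid_edge_def)
      with h show "(h \<circ> Hilbert_Choice.inv (grid_point n)) a = (h \<circ> Hilbert_Choice.inv (grid_point n)) b"
        by (auto simp: doubleton_eq_iff)
    qed (use uv in auto)
    then show "h u = h v" by simp
  qed
next
  assume conn: "tri_connected n T"
  show "uconnected (grid_point n ` triangle n, grid_edge n ` T)"
  proof (rule uconnectedI_constant)
    have "(1, 1) \<in> triangle n" using assms by (simp add: triangle_def)
    then show "grid_point n ` triangle n \<noteq> {}" by blast
    fix h :: "real \<times> real \<Rightarrow> int" and u v
    assume h: "\<And>a b. {a, b} \<in> grid_edge n ` T \<Longrightarrow> h a = h b"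
      and uv: "u \<in> grid_point n ` triangle n" "v \<in> grid_point n ` triangle n"
    have "\<forall>e \<in> T. (h \<circ> grid_point n) (tail e) = (h \<circ> grid_point n) (head e)"
      using h by (auto simp: grid_edge_def)
    with conn[unfolded tri_connected_def, THEN spec, THEN mp]
    have const: "\<forall>u \<in> triangle n. \<forall>v \<in> triangle n. (h \<circ> grid_point n) u = (h \<circ> grid_point n) v"
      by blast
    from uv obtain u' v' where uv': "u' \<in> triangle n" "u = grid_point n u'" "v' \<in> triangle n" "v = grid_point n v'"
      by blast
    from bspec[OF bspec[OF const uv'(1)] uv'(3)] show "h u = h v" unfolding uv'(2,4) o_def .
  qed
qed

text \<open>\<open>S\<close> is the complement of a spanning tree. By \<open>card_tri_edges\<close>
  it has as many edges as there are bounded faces, which is the size of a maximal minor.\<close>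

lemma card_spanning_utrees_quartered_aztec_diamond:
  assumes n: "1 \<le> n"
  shows "card (spanning_utrees (quartered_aztec_diamond n)) =
    card {S. S \<subseteq> tri_edges n \<and> card S = card (strict_triangle (n - 1)) \<and> tri_connected n (tri_edges n - S)}"
    (is "_ = card ?S")
proof -
  let ?V = "grid_point n ` triangle n" and ?E = "grid_edge n ` tri_edges n"
  let ?T = "{T. T \<subseteq> ?E \<and> card T + 1 = card ?V \<and> uconnected (?V, T)}"
  let ?f = "\<lambda>S. grid_edge n ` (tri_edges n - S)"
  have cardV: "card ?V = card (triangle n)" by (intro card_image inj_on_subset[OF inj_grid_point]) simp
  have cardf: "card (?f S) + 1 = card ?V \<longleftrightarrow> card S = card (strict_triangle (n - 1))" if "S \<subseteq> tri_edges n" for S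
  proof -
    have "card (?f S) = card (tri_edges n - S)"
      by (intro card_image inj_on_subset[OF inj_grid_edge]) simp
    also have "\<dots> = card (tri_edges n) - card S"
      using finite_subset[OF that] that by (intro card_Diff_subset) auto
    finally show ?thesis
      using card_tri_edges[OF n] cardV card_mono[OF finite_tri_edges that] by linarith
  qed
  have "bij_betw ?f ?S ?T"
    unfolding bij_betw_def
  proof
    show "inj_on ?f ?S"
    proof (rule inj_onI)
      fix S S' assume S: "S \<in> ?S" "S' \<in> ?S" and "?f S = ?f S'"
      then have "tri_edges n - S = tri_edges n - S'" by (simp only: inj_image_eq_iff[OF inj_grid_edge])
      moreover have "S \<subseteq> tri_edges n" "S' \<subseteq> tri_edges n" using S by simp_all
      ultimately show "S = S'" by blast
    qed
    show "?f ` ?S = ?T"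
    proof (intro equalityI subsetI)
      fix T assume "T \<in> ?f ` ?S"
      then obtain S where "S \<in> ?S" "T = ?f S" by blast
      then show "T \<in> ?T" using cardf[of S] uconnected_grid_point_iff[OF n] by auto
    next
      fix T assume T: "T \<in> ?T"
      then obtain D where D: "D \<subseteq> tri_edges n" "T = grid_edge n ` D" by (auto simp: subset_image_iff)
      then have "T = ?f (tri_edges n - D)" by (simp add: double_diff)
      moreover have "tri_edges n - D \<in> ?S"
        using T D cardf[of "tri_edges n - D"] uconnected_grid_point_iff[OF n] by (auto simp: double_diff)
      ultimately show "T \<in> ?f ` ?S" by blast
    qed
  qed
  then have "card ?S = card ?T" by (rule bij_betw_same_card)
  moreover have "wf_ugraph (?V, ?E)" using wf_quartered_aztec_diamond[of n] by (simp add: quartered_aztec_diamond_eq)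
  ultimately show ?thesis unfolding quartered_aztec_diamond_eq
    by (subst card_spanning_utrees) auto
qed

section \<open>Spectrum of the face Laplacian\<close>

text \<open>Multiplied by \<open>2 * sin (x / 2)\<close>, the cosines telescope. The bounds on
  \<open>m\<close> put \<open>?x / 2\<close> strictly between \<open>0\<close> and
  \<open>pi\<close>, so the sine can be cancelled.\<close>

lemma sum_cos_multiples_pi:
  assumes "0 < n" "0 < m" "m < 2 * n"
  shows "(\<Sum>a<n. cos (real a * (real m * pi / real n))) = (1 - (-1) ^ m) / 2"
proof -
  let ?x = "real m * pi / real n"
  have tele: "2 * sin (x / 2) * (\<Sum>a<k. cos (real a * x)) = sin (real k * x - x / 2) + sin (x / 2)"
    for x :: real and k
  proof (induction k)
    case (Suc k)
    have "2 * sin (x / 2) * cos (real k * x) = sin (real k * x + x / 2) - sin (real k * x - x / 2)"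
      by (simp add: sin_add sin_diff)
    moreover have "real (Suc k) * x - x / 2 = real k * x + x / 2"
      by (simp add: algebra_simps)
    ultimately show ?case using Suc by (simp add: distrib_left add.commute del: of_nat_Suc)
  qed simp
  have "real n * ?x = real m * pi" using assms by simp
  then have "2 * sin (?x / 2) * (\<Sum>a<n. cos (real a * ?x)) = (1 - (-1) ^ m) * sin (?x / 2)"
    unfolding tele by (simp add: sin_diff algebra_simps)
  moreover have "sin (?x / 2) > 0"
  proof (rule sin_gt_zero)
    have "real m < 2 * real n" using assms(3) by linarith
    then have "?x < 2 * pi" using assms by (simp add: divide_less_eq)
    then have "?x / 2 < 2 * pi / 2" by (rule divide_strict_right_mono) simp
    then show "?x / 2 < pi" by (simp only: nonzero_mult_div_cancel_left)
  qed (use assms in simp)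
  moreover have "S = c / 2" if "2 * s * S = c * s" "s > 0" for s S c :: real
  proof -
    have "s * (2 * S) = s * c" using that(1) by (simp only: mult_ac)
    then show ?thesis using that(2) by simp
  qed
  ultimately show ?thesis by blast
qed

text \<open>For \<open>k \<le> j\<close> the product formula gives half the difference of the cosine
  sums \<open>c (j - k)\<close> and \<open>c (j + k)\<close>. If \<open>k < j\<close>, the two
  arguments have equal parity and the sums cancel; if \<open>j = k\<close>, the first is
  \<open>n\<close> and the second vanishes.\<close>

lemma sin_orthogonal:
  assumes jk: "1 \<le> j" "j < n" "1 \<le> k" "k < n"
  shows "(\<Sum>a = 1..<n. sin (real j * real a * pi / real n) * sin (real k * real a * pi / real n)) =
    (if j = k then real n / 2 else 0)"
proof -
  define c where "c m = (\<Sum>a<n. cos (real a * (real m * pi / real n)))" for m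
  have c: "c m = (1 - (-1) ^ m) / 2" if "0 < m" "m < 2 * n" for m
    unfolding c_def using that jk by (intro sum_cos_multiples_pi) auto
  have main: "(\<Sum>a = 1..<n. sin (real j * real a * pi / real n) * sin (real k * real a * pi / real n)) =
      (c (j - k) - c (j + k)) / 2" if le: "k \<le> j" for j k
  proof -
    have "(\<Sum>a = 1..<n. sin (real j * real a * pi / real n) * sin (real k * real a * pi / real n)) =
        (\<Sum>a<n. sin (real j * real a * pi / real n) * sin (real k * real a * pi / real n))"
      by (rule sum.mono_neutral_left) (auto simp: not_less_eq_eq)
    also have "\<dots> = (\<Sum>a<n. (cos (real a * (real (j - k) * pi / real n)) - cos (real a * (real (j + k) * pi / real n))) / 2)"
    proof (rule sum.cong[OF refl])
      fix a
      have "real a * (real (j - k) * pi / real n) = real j * real a * pi / real n - real k * real a * pi / real n"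
        "real a * (real (j + k) * pi / real n) = real j * real a * pi / real n + real k * real a * pi / real n"
        using le by (auto simp: of_nat_diff algebra_simps diff_divide_distrib add_divide_distrib)
      then show "sin (real j * real a * pi / real n) * sin (real k * real a * pi / real n) =
          (cos (real a * (real (j - k) * pi / real n)) - cos (real a * (real (j + k) * pi / real n))) / 2"
        by (simp only: sin_times_sin)
    qed
    also have "\<dots> = (c (j - k) - c (j + k)) / 2"
      unfolding c_def by (simp add: sum_subtractf flip: sum_divide_distrib)
    finally show ?thesis .
  qed
  have ne: "(\<Sum>a = 1..<n. sin (real j * real a * pi / real n) * sin (real k * real a * pi / real n)) = 0"
    if "k < j" "j < n" "1 \<le> k" for j k
  proof -
    have "even (j - k) \<longleftrightarrow> even (j + k)" using that by simp
    then have "(-1 :: real) ^ (j - k) = (-1) ^ (j + k)" by (simp add: minus_one_power_iff)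
    then show ?thesis using main[of k j] c[of "j - k"] c[of "j + k"] that by simp
  qed
  show ?thesis
  proof (cases j k rule: linorder_cases)
    case equal
    have "c 0 = real n" by (simp add: c_def)
    then show ?thesis using main[of k j] c[of "j + k"] jk equal by simp
  next
    case greater
    then show ?thesis using ne[of k j] jk by simp
  next
    case less
    then show ?thesis using ne[of j k] jk by (simp add: mult.commute)
  qed
qed

text \<open>
  The Dirichlet eigenfunctions of the square grid that are antisymmetric under reflection in the
  diagonal, hence vanish on all three sides of the triangle.
\<close>

definition antisym_sine :: "nat \<Rightarrow> nat \<times> nat \<Rightarrow> nat \<times> nat \<Rightarrow> real" where
  "antisym_sine n = (\<lambda>(j, k) (a, b).
     sin (real j * real a * pi / real n) * sin (real k * real b * pi / real n)
     - sin (real k * real a * pi / real n) * sin (real j * real b * pi / real n))"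

lemma antisym_sine_sides:
  "antisym_sine n p (0, b) = 0" "antisym_sine n p (a, a) = 0" "0 < n \<Longrightarrow> antisym_sine n p (a, n) = 0"
  by (cases p; simp add: antisym_sine_def)+

text \<open>Over the full square the sum splits into products of one-dimensional inner products. The
  mixed ones vanish, since \<open>j = k'\<close> and \<open>k = j'\<close> cannot both hold when
  \<open>j < k\<close> and \<open>j' < k'\<close>.\<close>

lemma antisym_sine_orthogonal:
  assumes "p \<in> strict_triangle (n - 1)" "q \<in> strict_triangle (n - 1)"
  shows "(\<Sum>g \<in> strict_triangle (n - 1). antisym_sine n p g * antisym_sine n q g) = (if p = q then (real n / 2)\<^sup>2 else 0)"
proof -
  obtain j k j' k' where pq: "p = (j, k)" "q = (j', k')" by fastforce
  have jk: "1 \<le> j" "j < k" "k < n" "1 \<le> j'" "j' < k'" "k' < n"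
    using assms unfolding pq strict_triangle_def by auto
  define s where "s i a = sin (real i * real a * pi / real n)" for i a :: nat
  define ip where "ip i i' = (\<Sum>a = 1..<n. s i a * s i' a)" for i i'
  have ip: "ip i i' = (if i = i' then real n / 2 else 0)" if "1 \<le> i" "i < n" "1 \<le> i'" "i' < n" for i i'
    unfolding ip_def s_def using that by (rule sin_orthogonal)
  have ips: "(\<Sum>a = 1..<n. \<Sum>b = 1..<n. (s i a * s i' a) * (s l b * s l' b)) = ip i i' * ip l l'" for i i' l l'
    unfolding ip_def by (simp add: sum_product)
  let ?w = "\<lambda>g. antisym_sine n p g * antisym_sine n q g"
  have sq: "sum ?w ({1..<n} \<times> {1..<n}) = (if p = q then 2 * (real n / 2)\<^sup>2 else 0)"
  proof -
    have "sum ?w ({1..<n} \<times> {1..<n}) = (\<Sum>a = 1..<n. \<Sum>b = 1..<n.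
        (s j a * s j' a) * (s k b * s k' b) - (s j a * s k' a) * (s k b * s j' b)
        - (s k a * s j' a) * (s j b * s k' b) + (s k a * s k' a) * (s j b * s j' b))"
      unfolding pq sum.cartesian_product
      by (rule sum.cong[OF refl]) (auto simp: antisym_sine_def s_def algebra_simps)
    also have "\<dots> = ip j j' * ip k k' - ip j k' * ip k j' - ip k j' * ip j k' + ip k k' * ip j j'"
      by (simp only: sum.distrib sum_subtractf ips)
    also have "\<dots> = (if p = q then 2 * (real n / 2)\<^sup>2 else 0)"
      using jk by (auto simp: ip pq power2_eq_square)
    finally show ?thesis .
  qed
  \<comment> \<open>The sum over the square is twice the sum over the triangle, the diagonal contributing nothing.\<close>
  have swap: "?w (a, b) = ?w (b, a)" for a b
    by (simp add: pq antisym_sine_def algebra_simps)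
  let ?U = "strict_triangle (n - 1)"
  let ?L = "prod.swap ` ?U" and ?D = "(\<lambda>a. (a, a)) ` {1..<n}"
  have "sum ?w ({1..<n} \<times> {1..<n}) = sum ?w ((?U \<union> ?L) \<union> ?D)"
  proof (rule arg_cong[where f = "sum ?w"], intro equalityI subsetI)
    fix g assume "g \<in> {1..<n} \<times> {1..<n}"
    then obtain a b where g: "g = (a, b)" "1 \<le> a" "a < n" "1 \<le> b" "b < n" by auto
    show "g \<in> (?U \<union> ?L) \<union> ?D"
    proof (cases a b rule: linorder_cases)
      case less
      then show ?thesis using g by (auto simp: strict_triangle_def)
    next
      case greater
      then have "g = prod.swap (b, a)" "(b, a) \<in> ?U" using g by (auto simp: strict_triangle_def)
      then show ?thesis by blast
    qed (use g in auto)
  qed (use jk in \<open>auto simp: strict_triangle_def\<close>)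
  also have "\<dots> = sum ?w ?U + sum ?w ?L + sum ?w ?D"
  proof -
    have "?U \<inter> ?L = {}" "(?U \<union> ?L) \<inter> ?D = {}" by (auto simp: strict_triangle_def)
    then show ?thesis by (simp add: sum.union_disjoint)
  qed
  also have "sum ?w ?D = 0" by (rule sum.neutral) (auto simp: antisym_sine_sides)
  also have "sum ?w ?L = (\<Sum>g \<in> ?U. ?w (prod.swap g))"
    by (subst sum.reindex) (auto simp: inj_on_def)
  also have "\<dots> = sum ?w ?U"
    by (rule sum.cong) (auto simp: swap)
  finally show ?thesis using sq by (auto split: if_splits)
qed

text \<open>The Gram matrix of the faces acts as four times the value minus the values at the four
  neighbours. The eigenfunction vanishes on the sides of the triangle, so missing neighbours need no
  correction, and the addition formulas give a three-term recurrence in each coordinate.\<close>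

lemma antisym_sine_eigenvector:
  assumes p: "p = (j, k)" and f: "f \<in> strict_triangle (n - 1)" and n: "1 \<le> n"
  shows "(\<Sum>g \<in> strict_triangle (n - 1). (\<Sum>e \<in> tri_edges n. real_of_int (boundary f e) * real_of_int (boundary g e)) * antisym_sine n p g) =
    (4 - 2 * cos (real j * pi / real n) - 2 * cos (real k * pi / real n)) * antisym_sine n p f"
proof -
  obtain a b where ab: "f = (a, b)" "1 \<le> a" "a < b" "b < n" using f by (auto simp: strict_triangle_def)
  define v where "v g = (if g \<in> strict_triangle (n - 1) then antisym_sine n p g else 0)" for g
  \<comment> \<open>The zero extension \<open>v\<close> also agrees with the eigenfunction on the
    sides \<open>x = 0\<close>, \<open>x = y\<close> and \<open>y = n\<close>, where all neighbours
    that are not faces lie.\<close>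
  have v: "v (x, y) = antisym_sine n p (x, y)" if "x \<le> y" "y \<le> n" for x y
  proof (cases "(x, y) \<in> strict_triangle (n - 1)")
    case False
    then have "x = 0 \<or> x = y \<or> y = n" using that by (auto simp: strict_triangle_def)
    then show ?thesis using False n by (auto simp: v_def antisym_sine_sides)
  qed (simp add: v_def)
  define \<psi> where "\<psi> e = (\<Sum>g \<in> strict_triangle (n - 1). of_int (boundary g e) * v g)" for e
  have \<psi>: "1 \<le> y \<Longrightarrow> \<psi> (Hor x y) = v (x, y) - v (x, y - 1)"
      "1 \<le> x \<Longrightarrow> \<psi> (Ver x y) = v (x - 1, y) - v (x, y)" for x y
    unfolding \<psi>_def by (rule sum_boundary_faces; simp add: v_def)+
  have "(\<Sum>g \<in> strict_triangle (n - 1). (\<Sum>e \<in> tri_edges n. real_of_int (boundary f e) * real_of_int (boundary g e)) * antisym_sine n p g) =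
      (\<Sum>g \<in> strict_triangle (n - 1). \<Sum>e \<in> tri_edges n. real_of_int (boundary f e) * (real_of_int (boundary g e) * v g))"
    by (simp add: v_def sum_distrib_right mult.assoc)
  also have "\<dots> = (\<Sum>e \<in> tri_edges n. of_int (boundary f e) * \<psi> e)"
    unfolding \<psi>_def sum_distrib_left by (rule sum.swap)
  also have "\<dots> = \<psi> (Hor a b) - \<psi> (Hor a (Suc b)) + \<psi> (Ver (Suc a) b) - \<psi> (Ver a b)"
    using f unfolding ab(1) by (rule sum_boundary_tri_edges)
  also have "\<dots> = 4 * v (a, b) - v (a, b - 1) - v (a, Suc b) - v (a - 1, b) - v (Suc a, b)"
    using ab by (simp add: \<psi>)
  also have "\<dots> = 4 * antisym_sine n p (a, b) - antisym_sine n p (a, b - 1) - antisym_sine n p (a, Suc b)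
      - antisym_sine n p (a - 1, b) - antisym_sine n p (Suc a, b)"
    using ab by (simp add: v)
  also have "\<dots> = (4 - 2 * cos (real j * pi / real n) - 2 * cos (real k * pi / real n)) * antisym_sine n p f"
  proof -
    define \<theta> where "\<theta> i = real i * pi / real n" for i
    define s where "s i x = sin (real i * real x * pi / real n)" for i x
    have rec: "s i (x - 1) + s i (Suc x) = 2 * cos (\<theta> i) * s i x" if "1 \<le> x" for i x
    proof -
      have "real i * real (x - 1) * pi / real n = real i * real x * pi / real n - \<theta> i"
        "real i * real (Suc x) * pi / real n = real i * real x * pi / real n + \<theta> i"
        using that by (auto simp: \<theta>_def of_nat_diff algebra_simps diff_divide_distrib add_divide_distrib)
      then show ?thesis unfolding s_def by (simp only: sin_add sin_diff) simp
    qed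
    have antisym_sine: "antisym_sine n p (x, y) = s j x * s k y - s k x * s j y" for x y
      by (simp add: antisym_sine_def p s_def)
    have "antisym_sine n p (a, b - 1) + antisym_sine n p (a, Suc b) =
        s j a * (s k (b - 1) + s k (Suc b)) - s k a * (s j (b - 1) + s j (Suc b))"
      unfolding antisym_sine by (simp add: algebra_simps)
    also have "\<dots> = s j a * (2 * cos (\<theta> k) * s k b) - s k a * (2 * cos (\<theta> j) * s j b)"
      using ab rec[of b] by simp
    finally have 1: "antisym_sine n p (a, b - 1) + antisym_sine n p (a, Suc b) =
      s j a * (2 * cos (\<theta> k) * s k b) - s k a * (2 * cos (\<theta> j) * s j b)" .
    have "antisym_sine n p (a - 1, b) + antisym_sine n p (Suc a, b) =
        (s j (a - 1) + s j (Suc a)) * s k b - (s k (a - 1) + s k (Suc a)) * s j b"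
      unfolding antisym_sine by (simp add: algebra_simps)
    also have "\<dots> = (2 * cos (\<theta> j) * s j a) * s k b - (2 * cos (\<theta> k) * s k a) * s j b"
      using ab rec[of a] by simp
    finally have 2: "antisym_sine n p (a - 1, b) + antisym_sine n p (Suc a, b) =
      (2 * cos (\<theta> j) * s j a) * s k b - (2 * cos (\<theta> k) * s k a) * s j b" .
    have "4 * antisym_sine n p (a, b) - (antisym_sine n p (a, b - 1) + antisym_sine n p (a, Suc b))
        - (antisym_sine n p (a - 1, b) + antisym_sine n p (Suc a, b)) =
        (4 - 2 * cos (\<theta> j) - 2 * cos (\<theta> k)) * antisym_sine n p f"
      unfolding 1 2 unfolding ab(1) antisym_sine by (simp add: algebra_simps)
    then show ?thesis unfolding \<theta>_def by (simp only: diff_diff_eq add.assoc)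
  qed
  finally show ?thesis .
qed

section \<open>Counting spanning trees by minors\<close>

text \<open>A kernel vector, extended by zero to all edges, has no circulation around any face and
  so is the gradient of a potential. This potential is constant along the edges outside the chosen
  set, and nonconstant because the vector is nonzero. Conversely, the gradient of such a potential
  lies in the kernel.\<close>

lemma det_boundary_eq_0_iff:
  fixes fs :: "nat \<Rightarrow> nat \<times> nat"
  assumes fs: "bij_betw fs {0..<m} (strict_triangle (n - 1))"
    and f: "inj_on f {0..<m}" "f ` {0..<m} \<subseteq> tri_edges n"
  shows "det (mat m m (\<lambda>(i, j). boundary (fs i) (f j))) = 0 \<longleftrightarrow> \<not> tri_connected n (tri_edges n - f ` {0..<m})"
    (is "det ?A = 0 \<longleftrightarrow> _")
proof -
  let ?I = "{0..<m}" and ?T = "tri_edges n - f ` {0..<m}"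
  have fs_in: "fs i \<in> strict_triangle (n - 1)" if "i < m" for i
    using bij_betwE[OF fs] that by simp
  \<comment> \<open>For functions vanishing outside the chosen edges, the matrix product computes
    the full circulation.\<close>
  have sum_f: "(\<Sum>j = 0..<m. boundary g (f j) * \<psi> (f j)) = (\<Sum>e \<in> tri_edges n. boundary g e * \<psi> e)"
    if "\<And>e. e \<in> ?T \<Longrightarrow> \<psi> e = 0" for g and \<psi> :: "tri_edge \<Rightarrow> int"
  proof -
    have "(\<Sum>j = 0..<m. boundary g (f j) * \<psi> (f j)) = (\<Sum>e \<in> f ` ?I. boundary g e * \<psi> e)"
      using f(1) by (simp add: sum.reindex)
    also have "\<dots> = (\<Sum>e \<in> tri_edges n. boundary g e * \<psi> e)"
      using f(2) that by (intro sum.mono_neutral_left) auto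
    finally show ?thesis .
  qed
  have mult: "?A *\<^sub>v vec m w = vec m (\<lambda>i. \<Sum>j = 0..<m. boundary (fs i) (f j) * w j)" for w
    by (intro eq_vecI) (auto simp: scalar_prod_def)
  have "det ?A = 0 \<longleftrightarrow> (\<exists>w. w \<in> carrier_vec m \<and> w \<noteq> 0\<^sub>v m \<and> ?A *\<^sub>v w = 0\<^sub>v m)"
    by (rule det_0_iff_vec_prod_zero) simp
  also have "\<dots> \<longleftrightarrow> \<not> tri_connected n ?T"
  proof
    assume "\<exists>w. w \<in> carrier_vec m \<and> w \<noteq> 0\<^sub>v m \<and> ?A *\<^sub>v w = 0\<^sub>v m"
    then obtain w where w: "w \<in> carrier_vec m" "w \<noteq> 0\<^sub>v m" "?A *\<^sub>v w = 0\<^sub>v m" by blast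
    define \<psi> where "\<psi> e = (if e \<in> f ` ?I then w $ inv_into ?I f e else 0)" for e
    have \<psi>_f: "\<psi> (f j) = w $ j" if "j < m" for j
      using that f(1) by (simp add: \<psi>_def inv_into_f_f)
    have w_vec: "w = vec m (\<lambda>j. \<psi> (f j))" using w(1) \<psi>_f by (intro eq_vecI) auto
    have "(\<Sum>e \<in> tri_edges n. of_int (boundary g e) * \<psi> e) = 0" if "g \<in> strict_triangle (n - 1)" for g
    proof -
      have "g \<in> fs ` {0..<m}" using fs \<open>g \<in> _\<close> by (simp only: bij_betw_def)
      then obtain i where i: "i < m" "g = fs i" by auto
      have "(?A *\<^sub>v vec m (\<lambda>j. \<psi> (f j))) $ i = 0" using w(3) i(1) unfolding w_vec[symmetric] by simp
      then have "(\<Sum>j = 0..<m. boundary g (f j) * \<psi> (f j)) = 0" unfolding mult using i by simp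
      then show ?thesis using sum_f[of \<psi> g] by (simp add: \<psi>_def)
    qed
    then obtain h where h: "\<forall>e \<in> tri_edges n. \<psi> e = h (head e) - h (tail e)"
      using closed_imp_exact[of n \<psi>] by auto
    show "\<not> tri_connected n ?T"
    proof
      assume "tri_connected n ?T"
      moreover have "\<forall>e \<in> ?T. h (tail e) = h (head e)"
        using h by (auto simp: \<psi>_def)
      ultimately have const: "\<forall>u \<in> triangle n. \<forall>v \<in> triangle n. h u = h v" unfolding tri_connected_def by blast
      have "\<psi> (f j) = 0" if "j < m" for j
      proof -
        have "f j \<in> tri_edges n" using f(2) that by auto
        then have "\<psi> (f j) = h (head (f j)) - h (tail (f j))" "h (head (f j)) = h (tail (f j))"
          using h const tail_head_in_triangle by blast+
        then show ?thesis by simp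
      qed
      then have "w = 0\<^sub>v m" using w_vec by (intro eq_vecI) auto
      with w(2) show False by simp
    qed
  next
    assume "\<not> tri_connected n ?T"
    then obtain h :: "nat \<times> nat \<Rightarrow> int" where h: "\<forall>e \<in> ?T. h (tail e) = h (head e)"
      and ne: "\<not> (\<forall>u \<in> triangle n. \<forall>v \<in> triangle n. h u = h v)"
      unfolding tri_connected_def by blast
    define \<psi> where "\<psi> e = h (head e) - h (tail e)" for e
    let ?w = "vec m (\<lambda>j. \<psi> (f j))"
    have T0: "\<psi> e = 0" if "e \<in> ?T" for e using h that by (simp add: \<psi>_def)
    have "(\<Sum>j = 0..<m. boundary (fs i) (f j) * \<psi> (f j)) = 0" if "i < m" for i
    proof -
      obtain a b where ab: "fs i = (a, b)" by fastforce
      have "(\<Sum>e \<in> tri_edges n. boundary (fs i) e * \<psi> e) = 0"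
        using sum_boundary_tri_edges[of a b n \<psi>] fs_in[OF that] by (simp add: ab \<psi>_def)
      then show ?thesis using sum_f[of \<psi> "fs i", OF T0] by simp
    qed
    then have "?A *\<^sub>v ?w = 0\<^sub>v m" unfolding mult by (intro eq_vecI) auto
    moreover have "?w \<noteq> 0\<^sub>v m"
    proof
      assume "?w = 0\<^sub>v m"
      then have "\<psi> (f j) = 0" if "j < m" for j using that by (metis index_vec index_zero_vec(1))
      then have "\<forall>e \<in> tri_edges n. h (tail e) = h (head e)"
        using T0 by (force simp: \<psi>_def)
      then show False using ne tri_connected_tri_edges unfolding tri_connected_def by blast
    qed
    ultimately show "\<exists>w. w \<in> carrier_vec m \<and> w \<noteq> 0\<^sub>v m \<and> ?A *\<^sub>v w = 0\<^sub>v m"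
      by (intro exI[of _ ?w]) simp
  qed
  finally show ?thesis .
qed

text \<open>For injective \<open>f\<close> the minor is \<open>0\<close>, \<open>1\<close> or
  \<open>-1\<close>, and \<open>det_boundary_eq_0_iff\<close> tells when it vanishes; a repeated
  edge gives two equal columns.\<close>

lemma det_boundary_squared:
  fixes fs :: "nat \<Rightarrow> nat \<times> nat"
  assumes fs: "bij_betw fs {0..<m} (strict_triangle (n - 1))" and f: "f \<in> {0..<m} \<rightarrow>\<^sub>E tri_edges n"
  shows "(det (mat m m (\<lambda>(i, j). boundary (fs i) (f j))))\<^sup>2 =
    of_bool (inj_on f {0..<m} \<and> tri_connected n (tri_edges n - f ` {0..<m}))"
    (is "(det ?A)\<^sup>2 = _")
proof (cases "inj_on f {0..<m}")
  case True
  have "det ?A \<in> {-1, 0, 1}"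
  proof (rule det_at_most_one_pm1_per_column)
    show "?A \<in> carrier_mat m m" by simp
    show "?A $$ (i, j) \<in> {-1, 0, 1}" if "i < m" "j < m" for i j using that boundary_values by simp
    fix i i' j assume "i < m" "i' < m" "j < m" "?A $$ (i, j) = ?A $$ (i', j)" "?A $$ (i, j) \<noteq> 0"
    then have "fs i = fs i'" using boundary_inj[of "fs i" "f j" "fs i'"] by simp
    then show "i = i'" using fs \<open>i < m\<close> \<open>i' < m\<close> by (auto simp: bij_betw_def inj_on_def)
  qed
  moreover have "f ` {0..<m} \<subseteq> tri_edges n" using f by auto
  ultimately show ?thesis using det_boundary_eq_0_iff[OF fs True] True by auto
next
  case False
  then obtain i j where ij: "i < m" "j < m" "i \<noteq> j" "f i = f j" by (auto simp: inj_on_def)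
  then have "det ?A = 0"
    by (intro det_identical_columns[where n = m and i = i and j = j]) (auto intro!: eq_vecI)
  with False show ?thesis by simp
qed

text \<open>With the eigenvectors as columns of \<open>V\<close>, the relation
  \<open>?M * V = V * L\<close> holds for a diagonal \<open>L\<close>. By orthogonality
  \<open>det V\<close> is nonzero and cancels.\<close>

lemma det_boundary_gram:
  fixes fs :: "nat \<Rightarrow> nat \<times> nat"
  assumes fs: "bij_betw fs {0..<m} (strict_triangle (n - 1))" and n: "1 \<le> n"
  shows "det (mat m m (\<lambda>(i, j). \<Sum>e \<in> tri_edges n. real_of_int (boundary (fs i) e) * real_of_int (boundary (fs j) e))) =
    (\<Prod>(j, k) \<in> strict_triangle (n - 1). 4 - 2 * cos (real j * pi / real n) - 2 * cos (real k * pi / real n))"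
    (is "det ?M = prod ?ev _")
proof -
  \<comment> \<open>Faces and frequency pairs both range over
    \<open>strict_triangle (n - 1)\<close>, so \<open>fs\<close> enumerates the rows and the columns
    of \<open>V\<close> alike.\<close>
  define V where "V = mat m m (\<lambda>(i, j). antisym_sine n (fs j) (fs i))"
  define L where "L = mat m m (\<lambda>(i, j). if i = j then ?ev (fs j) else 0)"
  have carrier: "?M \<in> carrier_mat m m" "V \<in> carrier_mat m m" "L \<in> carrier_mat m m"
    by (simp_all add: V_def L_def)
  have fs_in: "fs i \<in> strict_triangle (n - 1)" if "i < m" for i
    using bij_betwE[OF fs] that by simp
  have sum_fs: "(\<Sum>k = 0..<m. F (fs k)) = sum F (strict_triangle (n - 1))" for F :: "nat \<times> nat \<Rightarrow> real"
    using fs by (rule sum.reindex_bij_betw)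
  have "?M * V = V * L"
  proof (rule eq_matI)
    fix i j assume "i < dim_row (V * L)" "j < dim_col (V * L)"
    then have ij: "i < m" "j < m" by (simp_all add: V_def L_def)
    obtain a b where ab: "fs j = (a, b)" by fastforce
    have "(?M * V) $$ (i, j) = (\<Sum>k = 0..<m.
        (\<Sum>e \<in> tri_edges n. real_of_int (boundary (fs i) e) * real_of_int (boundary (fs k) e)) * antisym_sine n (fs j) (fs k))"
      using ij by (simp add: V_def scalar_prod_def)
    also have "\<dots> = ?ev (fs j) * antisym_sine n (fs j) (fs i)"
      unfolding sum_fs[of "\<lambda>g. (\<Sum>e \<in> tri_edges n. real_of_int (boundary (fs i) e) * real_of_int (boundary g e)) * antisym_sine n (fs j) g"]
      using antisym_sine_eigenvector[OF ab fs_in[OF ij(1)] n] by (simp add: ab)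
    also have "\<dots> = (\<Sum>k = 0..<m. if k = j then antisym_sine n (fs k) (fs i) * ?ev (fs j) else 0)"
      using ij by simp
    also have "\<dots> = (V * L) $$ (i, j)"
      using ij by (simp add: V_def L_def scalar_prod_def if_distrib[of "\<lambda>x. _ * x"] cong: if_cong)
    finally show "(?M * V) $$ (i, j) = (V * L) $$ (i, j)" .
  qed (simp_all add: V_def L_def)
  then have "det ?M * det V = det V * det L"
    by (simp only: det_mult[OF carrier(1,2), symmetric] det_mult[OF carrier(2,3), symmetric])
  moreover have "det V \<noteq> 0"
  proof -
    have "transpose_mat V * V = (real n / 2)\<^sup>2 \<cdot>\<^sub>m 1\<^sub>m m"
    proof (rule eq_matI)
      fix i j assume "i < dim_row ((real n / 2)\<^sup>2 \<cdot>\<^sub>m 1\<^sub>m m)" "j < dim_col ((real n / 2)\<^sup>2 \<cdot>\<^sub>m 1\<^sub>m m)"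
      then have ij: "i < m" "j < m" by simp_all
      have "(transpose_mat V * V) $$ (i, j) = (\<Sum>k = 0..<m. antisym_sine n (fs i) (fs k) * antisym_sine n (fs j) (fs k))"
        using ij by (simp add: V_def scalar_prod_def)
      also have "\<dots> = (if fs i = fs j then (real n / 2)\<^sup>2 else 0)"
        unfolding sum_fs[of "\<lambda>g. antisym_sine n (fs i) g * antisym_sine n (fs j) g"]
        using ij by (intro antisym_sine_orthogonal fs_in)
      also have "fs i = fs j \<longleftrightarrow> i = j"
        using fs ij by (auto simp: bij_betw_def inj_on_def)
      finally show "(transpose_mat V * V) $$ (i, j) = ((real n / 2)\<^sup>2 \<cdot>\<^sub>m 1\<^sub>m m) $$ (i, j)"
        using ij by simp
    qed (simp_all add: V_def)
    then have "det (transpose_mat V) * det V = ((real n / 2)\<^sup>2) ^ m"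
      using det_mult[of "transpose_mat V" m V] carrier(2) by simp
    then show ?thesis using n by auto
  qed
  moreover have "det L = prod ?ev (strict_triangle (n - 1))"
  proof -
    have "det L = prod_list (diag_mat L)"
      by (rule det_upper_triangular[OF _ carrier(3)]) (auto simp: L_def upper_triangular_def)
    also have "\<dots> = (\<Prod>i = 0..<m. ?ev (fs i))"
      by (simp add: prod_list_diag_prod L_def)
    also have "\<dots> = prod ?ev (strict_triangle (n - 1))" using fs by (rule prod.reindex_bij_betw)
    finally show ?thesis .
  qed
  ultimately show ?thesis by simp
qed

theorem corollary2p3:
  fixes n :: nat
  assumes "n \<ge> 1"
  shows "real (card (spanning_utrees (quartered_aztec_diamond n))) =
    (\<Prod>(j, k) \<in> {(j, k). 1 \<le> j \<and> j < k \<and> k \<le> n - 1}.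
       4 - 2 * cos (real j * pi / real n) - 2 * cos (real k * pi / real n))"
proof -
  define m where "m = card (strict_triangle (n - 1))"
  obtain fs where fs: "bij_betw fs {0..<m} (strict_triangle (n - 1))"
    unfolding m_def using ex_bij_betw_nat_finite finite_strict_triangle by blast
  let ?c = "\<lambda>i e. real_of_int (boundary (fs i) e)"
  let ?Q = "\<lambda>S. tri_connected n (tri_edges n - S)"
  let ?F = "{0..<m} \<rightarrow>\<^sub>E tri_edges n"
  have det_c: "(det (mat m m (\<lambda>(i, j). ?c i (f j))))\<^sup>2 = of_bool (inj_on f {0..<m} \<and> ?Q (f ` {0..<m}))"
    if "f \<in> ?F" for f
  proof -
    \<comment> \<open>The minors are evaluated over the integers and the spectrum over the reals;
      the embedding commutes with determinants.\<close>
    have "mat m m (\<lambda>(i, j). ?c i (f j)) = map_mat real_of_int (mat m m (\<lambda>(i, j). boundary (fs i) (f j)))"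
      by (rule eq_matI) auto
    then have "(det (mat m m (\<lambda>(i, j). ?c i (f j))))\<^sup>2 =
        real_of_int ((det (mat m m (\<lambda>(i, j). boundary (fs i) (f j))))\<^sup>2)"
      by (simp add: of_int_hom.hom_det)
    also have "\<dots> = of_bool (inj_on f {0..<m} \<and> ?Q (f ` {0..<m}))"
      unfolding det_boundary_squared[OF fs that] by simp
    finally show ?thesis .
  qed
  \<comment> \<open>The factor \<open>fact m\<close> counts the orderings of each edge set; it
    reappears on the other side and cancels at the end.\<close>
  have "fact m * (\<Prod>(j, k) \<in> strict_triangle (n - 1). 4 - 2 * cos (real j * pi / real n) - 2 * cos (real k * pi / real n)) =
      (\<Sum>f \<in> ?F. (det (mat m m (\<lambda>(i, j). ?c i (f j))))\<^sup>2)"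
    using Cauchy_Binet_gram[of "tri_edges n" m ?c] det_boundary_gram[OF fs assms] by simp
  also have "\<dots> = (\<Sum>f \<in> ?F. of_bool (inj_on f {0..<m} \<and> ?Q (f ` {0..<m})))"
    using det_c by (rule sum.cong[OF refl])
  also have "\<dots> = real (card {f \<in> ?F. inj_on f {0..<m} \<and> ?Q (f ` {0..<m})})"
    by (subst sum_of_bool_eq) (auto intro!: finite_PiE simp: Int_def)
  also have "\<dots> = fact m * real (card {S. S \<subseteq> tri_edges n \<and> card S = m \<and> ?Q S})"
    by (simp only: card_injections_image[OF finite_tri_edges, where Q = ?Q and m = m] of_nat_mult of_nat_fact)
  also have "card {S. S \<subseteq> tri_edges n \<and> card S = m \<and> ?Q S} = card (spanning_utrees (quartered_aztec_diamond n))"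
    using card_spanning_utrees_quartered_aztec_diamond[OF assms] by (simp add: m_def)
  finally show ?thesis by (simp add: strict_triangle_def)
qed

end
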